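(* Assume (A1)–(A6) and $\alpha-\beta-1<\frac{4\theta}{\beta+1}$. Let $u(\cdot,\rho)$ be the regular solution of $L(u)+e^{f(u)}=0$, $u(0)=\rho$, $u'(0)=0$, and let $u^*(r)=u^*_{\lambda^*}(r(\lambda^* )^{-1/\theta})$, where $(u^*_{\lambda^*},\lambda^* )$ is the singular solution of Theorem 1.1 (so $u^*$ is a singular solution of $L(u)+e^{f(u)}=0$ near $0$). Then for every $\delta>0$, $$\lim_{\rho\to+\infty}\mathscr L_{(0,\delta)}\big(u(\cdot,\rho)-u^*\big)=+\infty,$$ where $\mathscr L_{(a,b)}(h)$ denotes the number of zeros of $h$ in $(a,b)$.
   Context: $L(u)(r)=r^{-\gamma}(r^{\alpha}|u'|^{\beta}u')'$, $\theta=\gamma+2+\beta-\alpha$, $g=f^{-1}$; "$O(g''(t))$" means bounded by $C|g''(t)|$ for large $t$, $o(t)$ any $h$ with $h(t)/t\to0$. (A1) $f\in C^4([0,\infty))$, $f'>0$, $f\to+\infty$. (A2) $g''(t)\to0$ and $f(g(t)+\varepsilon(t))/t\to1$ for every $\varepsilon(t)=O(g''(t))$. (A3) $g'(t)/g'(t+h(t))\to1$ for every $h=o(t)$. (A4) $\frac{g''(t)}{g'(t)}\ln g'(t)\to0$. (A5)(a) $g'''(\ln g')^n=O(g'')$, $n=0,1,2$, $g^{(4)}\ln g'=O(g'')$; (b) $\sup_{s\ge t}|g''(s)|=O(g''(t))$, $g''(t+h(t))=O(g''(t))$ for $h=o(t)$. (A6) $\alpha>\beta+1$, $\beta\ge0$,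 $\theta>0$. Theorem 1.1 provides $\lambda^*>0$ and a singular solution $u^*_{\lambda^*}$ of $L(u)+\lambda^*e^{f(u)}=0$ on $(0,1)$, $u^*_{\lambda^*}(1)=0$, $u^*_{\lambda^*}(r)\to+\infty$ as $r\to0^+$, with $u^*_{\lambda^*}(r)=g(Z(r))+O(g''(\ln r^{-\theta}))$, $Z(r)=\ln\{\theta^{\beta+1}(\alpha-\beta-1)\}-\ln\lambda^*-\theta\ln r+(\beta+1)\ln\{g'(\tau)+(\beta+1)g''(\tau)\ln g'(\tau)\}$, $\tau=\ln\frac{\beta+1}{\lambda^*r^\theta}$. *)

theory Defs
  imports "HOL-Analysis.Analysis"
begin

definition theta :: "real \<Rightarrow> real \<Rightarrow> real \<Rightarrow> real" where
  "theta \<alpha> \<beta> \<gamma> = \<gamma> + 2 + \<beta> - \<alpha>"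

definition flux :: "real \<Rightarrow> real \<Rightarrow> (real \<Rightarrow> real) \<Rightarrow> real \<Rightarrow> real" where
  "flux \<alpha> \<beta> du r = r powr \<alpha> * \<bar>du r\<bar> powr \<beta> * du r"

definition A1 :: "(real \<Rightarrow> real) \<Rightarrow> bool" where
  "A1 f \<longleftrightarrow> (\<exists>F :: nat \<Rightarrow> real \<Rightarrow> real. F 0 = f \<and>
      (\<forall>k<4. \<forall>x\<in>{0..}. (F k has_real_derivative F (Suc k) x) (at x within {0..})) \<and>
      continuous_on {0..} (F 4) \<and> (\<forall>x\<in>{0..}. F 1 x > 0)) \<and>
    filterlim f at_top at_top"

definition ginv :: "(real \<Rightarrow> real) \<Rightarrow> real \<Rightarrow> real" where
  "ginv f = inv_into {0..} f"

definition gder :: "nat \<Rightarrow> (real \<Rightarrow> real) \<Rightarrow> real \<Rightarrow> real" where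
  "gder k f = (deriv ^^ k) (ginv f)"

definition bigO_top :: "(real \<Rightarrow> real) \<Rightarrow> (real \<Rightarrow> real) \<Rightarrow> bool" where
  "bigO_top h k \<longleftrightarrow> (\<exists>C. \<forall>\<^sub>F t in at_top. \<bar>h t\<bar> \<le> C * \<bar>k t\<bar>)"

definition littleo_t :: "(real \<Rightarrow> real) \<Rightarrow> bool" where
  "littleo_t h \<longleftrightarrow> ((\<lambda>t. h t / t) \<longlongrightarrow> 0) at_top"

definition A2 :: "(real \<Rightarrow> real) \<Rightarrow> bool" where
  "A2 f \<longleftrightarrow> (gder 2 f \<longlongrightarrow> 0) at_top \<and>
     (\<forall>\<epsilon>. bigO_top \<epsilon> (gder 2 f) \<longrightarrow>
        ((\<lambda>t. f (ginv f t + \<epsilon> t) / t) \<longlongrightarrow> 1) at_top)"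

definition A3 :: "(real \<Rightarrow> real) \<Rightarrow> bool" where
  "A3 f \<longleftrightarrow> (\<forall>h. littleo_t h \<longrightarrow>
     ((\<lambda>t. gder 1 f t / gder 1 f (t + h t)) \<longlongrightarrow> 1) at_top)"

definition A4 :: "(real \<Rightarrow> real) \<Rightarrow> bool" where
  "A4 f \<longleftrightarrow> ((\<lambda>t. gder 2 f t / gder 1 f t * ln (gder 1 f t)) \<longlongrightarrow> 0) at_top"

definition A5 :: "(real \<Rightarrow> real) \<Rightarrow> bool" where
  "A5 f \<longleftrightarrow>
     (\<forall>n::nat\<in>{0,1,2}. bigO_top (\<lambda>t. gder 3 f t * (ln (gder 1 f t)) ^ n) (gder 2 f)) \<and>
     bigO_top (\<lambda>t. gder 4 f t * ln (gder 1 f t)) (gder 2 f) \<and>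
     bigO_top (\<lambda>t. SUP s\<in>{t..}. \<bar>gder 2 f s\<bar>) (gder 2 f) \<and>
     (\<forall>h. littleo_t h \<longrightarrow> bigO_top (\<lambda>t. gder 2 f (t + h t)) (gder 2 f))"

definition A6 :: "real \<Rightarrow> real \<Rightarrow> real \<Rightarrow> bool" where
  "A6 \<alpha> \<beta> \<gamma> \<longleftrightarrow> \<alpha> > \<beta> + 1 \<and> \<beta> \<ge> 0 \<and> theta \<alpha> \<beta> \<gamma> > 0"

text \<open>u solves L(u) + lam e^{f(u)} = 0 on the open set I, i.e.
  (r^alpha |u'|^beta u')' = - lam r^gamma e^{f(u)} there.\<close>
definition solves_on :: "(real \<Rightarrow> real) \<Rightarrow> real \<Rightarrow> real \<Rightarrow> real \<Rightarrow> real \<Rightarrow>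
    (real \<Rightarrow> real) \<Rightarrow> (real \<Rightarrow> real) \<Rightarrow> real set \<Rightarrow> bool" where
  "solves_on f \<alpha> \<beta> \<gamma> lam u du I \<longleftrightarrow>
     (\<forall>r\<in>I. (u has_real_derivative du r) (at r) \<and>
        (flux \<alpha> \<beta> du has_real_derivative (- lam * r powr \<gamma> * exp (f (u r)))) (at r))"

text \<open>Regular solution of L(u)+e^{f(u)}=0, u(0)=rho, u'(0)=0, on its maximal
  interval [0,R) of positivity (u(R)=0; f is only given on [0,oo)).\<close>
definition regular_sol :: "(real \<Rightarrow> real) \<Rightarrow> real \<Rightarrow> real \<Rightarrow> real \<Rightarrow> real \<Rightarrow>
    (real \<Rightarrow> real) \<Rightarrow> real \<Rightarrow> bool" where
  "regular_sol f \<alpha> \<beta> \<gamma> \<rho> u R \<longleftrightarrow> 0 < R \<and> u 0 = \<rho> \<and> u R = 0 \<and>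
     (\<forall>r\<in>{0..<R}. u r > 0) \<and> continuous_on {0..R} u \<and>
     (\<exists>du. du 0 = 0 \<and> continuous_on {0..<R} du \<and>
        (\<forall>r\<in>{0..<R}. (u has_real_derivative du r) (at r within {0..})) \<and>
        solves_on f \<alpha> \<beta> \<gamma> 1 u du {0<..<R})"

definition Zfun :: "(real \<Rightarrow> real) \<Rightarrow> real \<Rightarrow> real \<Rightarrow> real \<Rightarrow> real \<Rightarrow> real \<Rightarrow> real" where
  "Zfun f \<alpha> \<beta> \<gamma> lam r =
     (let th = theta \<alpha> \<beta> \<gamma>; \<tau> = ln ((\<beta> + 1) / (lam * r powr th)) in
      ln (th powr (\<beta> + 1) * (\<alpha> - \<beta> - 1)) - ln lam - th * ln r +
      (\<beta> + 1) * ln (gder 1 f \<tau> + (\<beta> + 1) * gder 2 f \<tau> * ln (gder 1 f \<tau>)))"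

definition singular_sol_thm11 :: "(real \<Rightarrow> real) \<Rightarrow> real \<Rightarrow> real \<Rightarrow> real \<Rightarrow> real \<Rightarrow>
    (real \<Rightarrow> real) \<Rightarrow> bool" where
  "singular_sol_thm11 f \<alpha> \<beta> \<gamma> lam v \<longleftrightarrow> lam > 0 \<and>
     (\<exists>dv. solves_on f \<alpha> \<beta> \<gamma> lam v dv {0<..<1}) \<and>
     continuous_on {0<..1} v \<and> v 1 = 0 \<and>
     filterlim v at_top (at_right 0) \<and>
     (\<exists>C. \<forall>\<^sub>F r in at_right 0.
        \<bar>v r - ginv f (Zfun f \<alpha> \<beta> \<gamma> lam r)\<bar> \<le> C * \<bar>gder 2 f (ln (r powr (- theta \<alpha> \<beta> \<gamma>)))\<bar>)"

definition nzeros :: "(real \<Rightarrow> real) \<Rightarrow> real set \<Rightarrow> enat" where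
  "nzeros h S = (let Z = {r\<in>S. h r = 0} in if finite Z then enat (card Z) else \<infinity>)"

end

theory Submission
  imports Defs "HOL-Complex_Analysis.Great_Picard"
begin

text \<open>Let \<open>t = f \<rho>\<close>, choose \<open>r\<close> by \<open>r powr \<theta> = g'(t) powr (\<beta> + 1) * exp (- t)\<close> and put
  \<open>z(s) = (u(r s) - \<rho>) / g'(t)\<close>. Because \<open>g'\<close> is slowly varying, \<open>f(u(r s)) = t + z(s) + o(1)\<close>, so
  along subsequences \<open>z\<close> converges to a regular solution of the Gelfand equation
  \<open>L(Z) + exp Z = 0\<close>, while the asymptotics of Theorem 1.1 make the rescaled singular solution
  converge to \<open>ln (\<theta> powr (\<beta> + 1) * (\<alpha> - \<beta> - 1)) - \<theta> ln s\<close>. Under the condition on the exponents the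
  corresponding equilibrium of the Emden-Fowler system is a focus, so the difference of the two limits
  changes sign infinitely often. Finitely many sign changes survive the passage to large \<open>\<rho>\<close>, and the
  points \<open>r s\<close> where they occur tend to 0.\<close>

section \<open>The Emden-Fowler system\<close>

text \<open>\<open>U \<rho>\<close> is governed by the equation only up to its zero
  \<open>R \<rho>\<close>, so the rescaled right-hand side is stopped there; since
  \<open>g / g1\<close> tends to infinity, this zero leaves every bounded rescaled interval. No
  uniqueness or continuous dependence is proved for the Gelfand equation. Integrated twice it
  becomes the fixed-point equation \<open>Z = frozen_sol \<alpha> \<beta> \<gamma> Z\<close>, which
  is stable under pointwise limits. Every nonpositive continuous fixed point oscillates, so it is
  enough to find one limit along a sequence of values of \<open>\<rho>\<close> at which the count is
  assumed to fail. A strict sign at finitely many points is an open condition, so pointwise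
  convergence suffices. The constant 4 is a discriminant. With \<open>q = P - 1\<close> the
  linearised system is \<open>w' = - \<theta> m q\<close>, \<open>q' = \<kappa> (w - q)\<close>,
  with characteristic polynomial \<open>X^2 + \<kappa> X + \<kappa> \<theta> m\<close> of
  discriminant \<open>\<kappa> (\<kappa> - 4 \<theta> m)\<close>, where
  \<open>m = 1 / (\<beta> + 1)\<close>. The limit never reaches the equilibrium: it stays
  nonpositive, while the singular solution is unbounded at 0.\<close>

lemma relaxation_lower_bound:
  fixes P w :: "real \<Rightarrow> real" and \<kappa> \<sigma> c x0 :: real
  assumes dP: "\<And>x. x \<ge> x0 \<Longrightarrow> (P has_real_derivative \<kappa> * (exp (w x) - P x)) (at x)"
    and "\<kappa> \<ge> 0" and c: "\<And>x. x \<ge> x0 \<Longrightarrow> \<sigma> * (exp (w x) - 1) \<ge> c" and "x \<ge> x0"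
  shows "\<sigma> * (P x - 1) \<ge> c + (\<sigma> * (P x0 - 1) - c) * exp (- \<kappa> * (x - x0))"
proof -
  \<comment> \<open>Integrating factor: it removes the damping term, so \<open>?F\<close> is
    nondecreasing as long as the forcing stays above \<open>c\<close>.\<close>
  let ?F = "\<lambda>x. exp (\<kappa> * x) * (\<sigma> * (P x - 1) - c)"
  have "?F x0 \<le> ?F x"
  proof (rule DERIV_nonneg_imp_nondecreasing[OF \<open>x \<ge> x0\<close>, where f = ?F])
    fix t assume t: "x0 \<le> t" "t \<le> x"
    have "(?F has_real_derivative \<kappa> * exp (\<kappa> * t) * (\<sigma> * (exp (w t) - 1) - c)) (at t)"
      by (auto intro!: derivative_eq_intros dP t simp: algebra_simps)
    moreover have "\<kappa> * exp (\<kappa> * t) * (\<sigma> * (exp (w t) - 1) - c) \<ge> 0"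
      using c[OF t(1)] \<open>\<kappa> \<ge> 0\<close> by (intro mult_nonneg_nonneg) auto
    ultimately show "\<exists>y. (?F has_real_derivative y) (at t) \<and> 0 \<le> y" by blast
  qed
  then have "exp (- \<kappa> * x) * ?F x0 \<le> exp (- \<kappa> * x) * ?F x"
    by (intro mult_left_mono) auto
  moreover have "exp (- \<kappa> * x) * exp (\<kappa> * x) = 1"
    "exp (- \<kappa> * x) * exp (\<kappa> * x0) = exp (- \<kappa> * (x - x0))"
    by (simp_all add: exp_add[symmetric] algebra_simps)
  ultimately have "exp (- \<kappa> * (x - x0)) * (\<sigma> * (P x0 - 1) - c) \<le> \<sigma> * (P x - 1) - c"
    by (simp only: mult.assoc[symmetric]) simp
  then show ?thesis by (simp add: mult.commute)
qed

text \<open>The initial deviation decays at rate \<open>\<kappa>\<close>, so \<open>P\<close>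
  inherits, up to any loss, a one-sided bound that \<open>exp w\<close> satisfies on a half-line.
  The sign \<open>\<sigma>\<close> serves both sides of 1 at once.\<close>

lemma relaxation_eventually_ge:
  fixes P w :: "real \<Rightarrow> real" and \<kappa> \<sigma> c x0 :: real
  assumes dP: "\<And>x. x \<ge> x0 \<Longrightarrow> (P has_real_derivative \<kappa> * (exp (w x) - P x)) (at x)"
    and "\<kappa> > 0" and c: "\<And>x. x \<ge> x0 \<Longrightarrow> \<sigma> * (exp (w x) - 1) \<ge> c" and "d < c"
  shows "\<forall>\<^sub>F x in at_top. \<sigma> * (P x - 1) > d"
proof -
  have "((\<lambda>x. exp (- (\<kappa> * (x - x0)))) \<longlongrightarrow> 0) at_top"
    using \<open>\<kappa> > 0\<close>
    by (intro filterlim_compose[OF exp_at_bot] filterlim_compose[OF filterlim_uminus_at_bot_at_top]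
        filterlim_tendsto_pos_mult_at_top[OF tendsto_const]
        filterlim_tendsto_add_at_top[where c = "-x0" and f = "\<lambda>_. -x0" and g = "\<lambda>x. x", simplified] filterlim_ident) auto
  then have "((\<lambda>x. c + (\<sigma> * (P x0 - 1) - c) * exp (- \<kappa> * (x - x0))) \<longlongrightarrow> c + (\<sigma> * (P x0 - 1) - c) * 0) at_top"
    by (intro tendsto_intros) simp
  then have "\<forall>\<^sub>F x in at_top. d < c + (\<sigma> * (P x0 - 1) - c) * exp (- \<kappa> * (x - x0))"
    using order_tendstoD(1) \<open>d < c\<close> by fastforce
  with eventually_ge_at_top[of x0] show ?thesis
    by eventually_elim (use relaxation_lower_bound[OF dP _ c] \<open>\<kappa> > 0\<close> in fastforce)
qed

text \<open>Near 0 a difference quotient exceeds the derivative minus \<open>\<epsilon>\<close>.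
  Multiplying it by the square of the increment avoids a case split on the sign and produces the
  terms of the quadratic form in \<open>nonresonant_margin\<close>.\<close>

lemma exp_powr_near_linear:
  fixes \<epsilon> m :: real
  assumes "\<epsilon> > 0"
  obtains d where "d > 0" "\<And>w. \<bar>w\<bar> < d \<Longrightarrow> (exp w - 1) * w \<ge> (1 - \<epsilon>) * w\<^sup>2"
    "\<And>q. \<bar>q\<bar> < d \<Longrightarrow> ((1 + q) powr m - 1) * q \<ge> (m - \<epsilon>) * q\<^sup>2"
proof -
  have secant: "\<forall>\<^sub>F q in at 0. (F q - F 0) * q \<ge> (D - \<epsilon>) * q\<^sup>2"
    if "(F has_real_derivative D) (at 0)" for F and D :: real
  proof -
    have "((\<lambda>q. (F q - F 0) / q) \<longlongrightarrow> D) (at 0)"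
      using that by (simp add: has_field_derivative_iff)
    then have "\<forall>\<^sub>F q in at 0. (F q - F 0) / q > D - \<epsilon>"
      using order_tendstoD(1) \<open>\<epsilon> > 0\<close> by fastforce
    moreover have "\<forall>\<^sub>F q in at 0. q \<noteq> (0::real)" by (simp add: eventually_at_filter)
    ultimately show ?thesis
    proof eventually_elim
      case (elim q)
      then have "(D - \<epsilon>) * q\<^sup>2 \<le> (F q - F 0) / q * q\<^sup>2"
        by (intro mult_right_mono) auto
      then show ?case using elim by (simp add: power2_eq_square)
    qed
  qed
  have "\<forall>\<^sub>F q in at (0::real). (exp q - exp 0) * q \<ge> (1 - \<epsilon>) * q\<^sup>2"
    by (rule secant) (auto intro!: derivative_eq_intros)
  moreover have "\<forall>\<^sub>F q in at (0::real). ((1+q) powr m - (1+0) powr m) * q \<ge> (m - \<epsilon>) * q\<^sup>2"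
    by (rule secant) (auto intro!: derivative_eq_intros)
  ultimately have "\<forall>\<^sub>F q in at (0::real). (exp q - exp 0) * q \<ge> (1 - \<epsilon>) * q\<^sup>2 \<and>
      ((1+q) powr m - (1+0) powr m) * q \<ge> (m - \<epsilon>) * q\<^sup>2"
    by eventually_elim auto
  then obtain d where d: "d > 0" "\<And>q. q \<noteq> 0 \<Longrightarrow> \<bar>q\<bar> < d \<Longrightarrow> (exp q - exp 0) * q \<ge> (1 - \<epsilon>) * q\<^sup>2 \<and>
      ((1+q) powr m - (1+0) powr m) * q \<ge> (m - \<epsilon>) * q\<^sup>2"
    by (auto simp: eventually_at dist_real_def)
  show thesis
  proof (rule that[OF d(1)])
    fix q :: real assume q: "\<bar>q\<bar> < d"
    show "(exp q - 1) * q \<ge> (1 - \<epsilon>) * q\<^sup>2" using d(2)[OF _ q] by (cases "q = 0") auto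
    show "((1 + q) powr m - 1) * q \<ge> (m - \<epsilon>) * q\<^sup>2" using d(2)[OF _ q] by (cases "q = 0") auto
  qed
qed

text \<open>At \<open>\<epsilon> = 0\<close> the form on the left has discriminant
  \<open>\<kappa> * (\<kappa> - 4 * \<theta> * m) < 0\<close>, hence is positive definite; this is
  where the focus condition enters.\<close>

lemma nonresonant_margin:
  fixes \<kappa> \<theta> m :: real
  assumes "\<kappa> > 0" "\<theta> > 0" "m > 0" "\<kappa> < 4 * \<theta> * m"
  obtains \<epsilon> where "\<epsilon> > 0"
    "\<And>w q. \<kappa> * ((1 - \<epsilon>) * w\<^sup>2) - \<kappa> * q * w + \<theta> * ((m - \<epsilon>) * q\<^sup>2) \<ge> \<epsilon> * (w\<^sup>2 + q\<^sup>2)"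
proof -
  \<comment> \<open>Coefficients of \<open>w\<^sup>2\<close> and \<open>q\<^sup>2\<close> once
    \<open>e * (w\<^sup>2 + q\<^sup>2)\<close> is moved to the left. The strict discriminant
    inequality at \<open>e = 0\<close> persists for small \<open>e\<close> by continuity.\<close>
  let ?A = "\<lambda>e. \<kappa> * (1 - e) - e" and ?B = "\<lambda>e. \<theta> * (m - e) - e"
  have "((\<lambda>e. 4 * ?A e * ?B e) \<longlongrightarrow> 4 * ?A 0 * ?B 0) (at_right 0)" by (intro tendsto_intros)
  moreover have "4 * ?A 0 * ?B 0 > \<kappa>\<^sup>2"
    using mult_strict_left_mono[OF assms(4,1)] by (simp add: power2_eq_square algebra_simps)
  ultimately have "\<forall>\<^sub>F e in at_right 0. 4 * ?A e * ?B e > \<kappa>\<^sup>2" by (rule order_tendstoD)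
  moreover have "(?A \<longlongrightarrow> ?A 0) (at_right 0)" by (intro tendsto_intros)
  then have "\<forall>\<^sub>F e in at_right 0. ?A e > 0" by (rule order_tendstoD) (use assms in auto)
  moreover have "\<forall>\<^sub>F e in at_right (0::real). e > 0" by (simp add: eventually_at_filter)
  ultimately have "\<forall>\<^sub>F e in at_right 0. 4 * ?A e * ?B e > \<kappa>\<^sup>2 \<and> ?A e > 0 \<and> e > 0"
    by eventually_elim auto
  then obtain e where e: "4 * ?A e * ?B e > \<kappa>\<^sup>2" "?A e > 0" "e > 0"
    using eventually_happens'[OF trivial_limit_at_right_real] by blast
  show thesis
  proof (rule that[OF e(3)])
    fix w q :: real
    have "4 * ?A e * (?A e * w\<^sup>2 - \<kappa> * q * w + ?B e * q\<^sup>2) =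
        (2 * ?A e * w - \<kappa> * q)\<^sup>2 + (4 * ?A e * ?B e - \<kappa>\<^sup>2) * q\<^sup>2"
      by (simp add: power2_eq_square algebra_simps)
    also have "\<dots> \<ge> 0" using e(1) by auto
    finally have "?A e * w\<^sup>2 - \<kappa> * q * w + ?B e * q\<^sup>2 \<ge> 0"
      using e(2) by (simp add: zero_le_mult_iff)
    then show "\<kappa> * ((1 - e) * w\<^sup>2) - \<kappa> * q * w + \<theta> * ((m - e) * q\<^sup>2) \<ge> e * (w\<^sup>2 + q\<^sup>2)"
      by (simp add: algebra_simps)
  qed
qed

text \<open>Near the equilibrium \<open>w = 0\<close>, \<open>P = 1\<close> the linearisation is a focus, so the slope
  \<open>(P - 1) / w\<close> satisfies a Riccati inequality without equilibria and blows up in finite time.\<close>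

lemma focus_no_sign_near_equilibrium:
  fixes w P :: "real \<Rightarrow> real" and \<kappa> \<theta> m x0 :: real
  assumes par: "\<kappa> > 0" "\<theta> > 0" "m > 0" "\<kappa> < 4 * \<theta> * m"
    and dw: "\<And>x. (w has_real_derivative \<theta> * (1 - P x powr m)) (at x)"
    and dP: "\<And>x. (P has_real_derivative \<kappa> * (exp (w x) - P x)) (at x)"
    and lim: "(w \<longlongrightarrow> 0) at_top" "(P \<longlongrightarrow> 1) at_top"
    and nz: "\<forall>\<^sub>F x in at_top. w x \<noteq> 0"
  shows False
proof -
  obtain \<epsilon> where \<epsilon>: "\<epsilon> > 0"
    "\<And>w q. \<kappa> * ((1 - \<epsilon>) * w\<^sup>2) - \<kappa> * q * w + \<theta> * ((m - \<epsilon>) * q\<^sup>2) \<ge> \<epsilon> * (w\<^sup>2 + q\<^sup>2)"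
    using nonresonant_margin[OF par] by metis
  obtain d where d: "d > 0" "\<And>w. \<bar>w\<bar> < d \<Longrightarrow> (exp w - 1) * w \<ge> (1 - \<epsilon>) * w\<^sup>2"
    "\<And>q. \<bar>q\<bar> < d \<Longrightarrow> ((1 + q) powr m - 1) * q \<ge> (m - \<epsilon>) * q\<^sup>2"
    using exp_powr_near_linear[OF \<epsilon>(1), of m] by metis
  have "\<forall>\<^sub>F x in at_top. \<bar>w x\<bar> < d" "\<forall>\<^sub>F x in at_top. \<bar>P x - 1\<bar> < d"
    using tendstoD[OF lim(1) d(1)] tendstoD[OF lim(2) d(1)] by (simp_all add: dist_real_def)
  with nz have "\<forall>\<^sub>F x in at_top. w x \<noteq> 0 \<and> \<bar>w x\<bar> < d \<and> \<bar>P x - 1\<bar> < d"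
    by eventually_elim auto
  then obtain a where a: "\<And>x. x \<ge> a \<Longrightarrow> w x \<noteq> 0 \<and> \<bar>w x\<bar> < d \<and> \<bar>P x - 1\<bar> < d"
    by (auto simp: eventually_at_top_linorder)
  let ?y = "\<lambda>x. (P x - 1) / w x"
  \<comment> \<open>\<open>arctan\<close> of the slope grows at rate at least
    \<open>\<epsilon>\<close>, so over this length it would gain \<open>2 * pi\<close>, while its
    range has width only \<open>pi\<close>.\<close>
  let ?b = "a + 2 * pi / \<epsilon>"
  have "arctan (?y a) - \<epsilon> * a \<le> arctan (?y ?b) - \<epsilon> * ?b"
  proof (rule DERIV_nonneg_imp_nondecreasing[where f = "\<lambda>x. arctan (?y x) - \<epsilon> * x"])
    fix x assume "a \<le> x" "x \<le> ?b"
    note ax = a[OF \<open>a \<le> x\<close>]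
    let ?q = "P x - 1"
    \<comment> \<open>The numerator \<open>q' w - q w'\<close> of the derivative of the slope
      \<open>q / w\<close>; the derivative of the angle is
      \<open>?N / (w\<^sup>2 + q\<^sup>2)\<close>.\<close>
    let ?N = "\<kappa> * (exp (w x) - P x) * w x - ?q * (\<theta> * (1 - P x powr m))"
    have "((\<lambda>x. arctan (?y x) - \<epsilon> * x) has_real_derivative
        inverse (1 + (?y x)\<^sup>2) * (?N / (w x * w x)) - \<epsilon>) (at x)"
      using ax by (auto intro!: derivative_eq_intros dw dP DERIV_chain2[OF DERIV_arctan])
    moreover have "?N = \<kappa> * ((exp (w x) - 1) * w x) - \<kappa> * ?q * w x + \<theta> * (((1 + ?q) powr m - 1) * ?q)"
      by (simp add: algebra_simps)
    then have "?N \<ge> \<kappa> * ((1 - \<epsilon>) * (w x)\<^sup>2) - \<kappa> * ?q * w x + \<theta> * ((m - \<epsilon>) * ?q\<^sup>2)"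
      using mult_left_mono[OF d(2)[of "w x"], of \<kappa>] mult_left_mono[OF d(3)[of ?q], of \<theta>] ax par by linarith
    then have N: "?N \<ge> \<epsilon> * ((w x)\<^sup>2 + ?q\<^sup>2)" using \<epsilon>(2)[of "w x" ?q] by linarith
    have "inverse (1 + (q / u)\<^sup>2) * (N / (u * u)) = N / (u\<^sup>2 + q\<^sup>2)" if "u \<noteq> 0" for q u N :: real
      using that by (simp add: divide_simps power2_eq_square add_nonneg_eq_0_iff)
    then have "inverse (1 + (?y x)\<^sup>2) * (?N / (w x * w x)) = ?N / ((w x)\<^sup>2 + ?q\<^sup>2)"
      using ax by blast
    moreover have "(w x)\<^sup>2 + ?q\<^sup>2 > 0" using ax by (simp add: add_pos_nonneg)
    ultimately show "\<exists>y. ((\<lambda>x. arctan (?y x) - \<epsilon> * x) has_real_derivative y) (at x) \<and> 0 \<le> y"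
      using N by (intro exI[of _ "inverse (1 + (?y x)\<^sup>2) * (?N / (w x * w x)) - \<epsilon>"])
        (simp add: pos_le_divide_eq)
  qed (use \<epsilon> in auto)
  then have "arctan (?y a) + 2 * pi \<le> arctan (?y ?b)"
    using \<epsilon> by (simp add: algebra_simps)
  with arctan_bounded[of "?y a"] arctan_bounded[of "?y ?b"] pi_gt_zero show False by linarith
qed

text \<open>For \<open>\<sigma> = 1\<close> this uses \<open>exp w + exp (- w) \<ge> 2\<close>; for
  \<open>\<sigma> = -1\<close> it is monotonicity. The common bound lets both signs share one
  argument.\<close>

lemma signed_exp_minus_one_ge:
  fixes \<sigma> e w :: real
  assumes "\<sigma> = 1 \<or> \<sigma> = -1" "\<sigma> * w \<ge> e"
  shows "\<sigma> * (exp w - 1) \<ge> 1 - exp (- e)"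
proof (cases "\<sigma> = 1")
  case True
  have "1 - exp (- w) \<le> exp w - 1"
    using exp_minus_inverse[of w] sum_squares_bound[of 1 "exp w"] 
    by (simp add: exp_minus field_simps power2_eq_square)
  moreover have "exp (- w) \<le> exp (- e)" using True assms by simp
  ultimately have "1 - exp (- e) \<le> exp w - 1" by linarith
  with True show ?thesis by simp
next
  case False
  then show ?thesis using assms by auto
qed

lemma signed_powr_minus_one:
  fixes \<sigma> m p :: real
  assumes "\<sigma> = 1 \<or> \<sigma> = -1" "m > 0" "p > 0"
  shows "\<sigma> * (p powr m - 1) \<ge> 0 \<longleftrightarrow> \<sigma> * (p - 1) \<ge> 0"
    "\<sigma> * (p powr m - 1) > 0 \<longleftrightarrow> \<sigma> * (p - 1) > 0"
proof -
  have "p < 1 \<Longrightarrow> p powr m < 1" "p > 1 \<Longrightarrow> p powr m > 1"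
    using powr_less_mono2[of m p 1] powr_less_mono2[of m 1 p] assms(2,3) by simp_all
  with assms(1) show "\<sigma> * (p powr m - 1) \<ge> 0 \<longleftrightarrow> \<sigma> * (p - 1) \<ge> 0"
    "\<sigma> * (p powr m - 1) > 0 \<longleftrightarrow> \<sigma> * (p - 1) > 0"
    by (cases p "1::real" rule: linorder_cases; force)+
qed

text \<open>If \<open>\<sigma> * w\<close> stayed nonnegative, \<open>P\<close> would be driven to
  the same side of 1 and \<open>\<sigma> * w\<close> would then decrease. The orbit would converge
  to the equilibrium with \<open>w\<close> nonzero, which a focus forbids; \<open>ne\<close>
  excludes the constant orbit.\<close>

lemma gelfand_system_changes_sign:
  fixes w P :: "real \<Rightarrow> real" and \<kappa> \<theta> m X \<sigma> :: real
  assumes par: "\<kappa> > 0" "\<theta> > 0" "m > 0" "\<kappa> < 4 * \<theta> * m"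
    and dw: "\<And>x. (w has_real_derivative \<theta> * (1 - P x powr m)) (at x)"
    and dP: "\<And>x. (P has_real_derivative \<kappa> * (exp (w x) - P x)) (at x)"
    and pos: "\<And>x. P x > 0" and ne: "\<And>x. w x \<noteq> 0 \<or> P x \<noteq> 1"
    and \<sigma>: "\<sigma> = 1 \<or> \<sigma> = -1"
  shows "\<exists>x>X. \<sigma> * w x < 0"
proof (rule ccontr)
  assume "\<not> ?thesis"
  then have sgn: "\<And>x. x > X \<Longrightarrow> \<sigma> * w x \<ge> 0" by force
  have P_away: "\<forall>\<^sub>F x in at_top. \<sigma> * (P x - 1) > d"
    if "\<And>x. x \<ge> a \<Longrightarrow> \<sigma> * w x \<ge> e" "d < 1 - exp (- e)" for a e d
    by (rule relaxation_eventually_ge[OF dP par(1) signed_exp_minus_one_ge[OF \<sigma>], of a])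
      (use that in auto)
  have dsw: "((\<lambda>x. \<sigma> * w x) has_real_derivative - \<theta> * (\<sigma> * (P x powr m - 1))) (at x)" for x
    by (auto intro!: derivative_eq_intros dw simp: algebra_simps)
  \<comment> \<open>Otherwise \<open>\<sigma> * w\<close> increases strictly, hence stays above a
    positive constant, and the relaxation drags \<open>P\<close> across 1.\<close>
  have "\<exists>x>X. \<sigma> * (P x - 1) \<ge> 0"
  proof (rule ccontr)
    assume "\<not> ?thesis"
    then have neg: "\<sigma> * (P x - 1) < 0" if "x > X" for x using that by force
    then have neg': "\<sigma> * (P x powr m - 1) < 0" if "x > X" for x
      using that signed_powr_minus_one(1)[OF \<sigma> par(3) pos[of x]] by force
    have incr: "\<sigma> * w a < \<sigma> * w b" if "X < a" "a < b" for a b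
    proof (rule DERIV_pos_imp_increasing[OF that(2), where f = "\<lambda>x. \<sigma> * w x"])
      fix x assume "a \<le> x" "x \<le> b"
      then have "- \<theta> * (\<sigma> * (P x powr m - 1)) > 0"
        using neg'[of x] that par by (intro mult_neg_neg) auto
      with dsw[of x] show "\<exists>y. ((\<lambda>x. \<sigma> * w x) has_real_derivative y) (at x) \<and> 0 < y" by blast
    qed
    have "\<sigma> * w (X+2) > 0" using incr[of "X+1" "X+2"] sgn[of "X+1"] by linarith
    then have "\<forall>\<^sub>F x in at_top. \<sigma> * (P x - 1) > 0"
      using incr by (intro P_away[of "X+2" "\<sigma> * w (X+2)"]) (auto simp: le_less)
    then obtain x where "x > X" "\<sigma> * (P x - 1) > 0"
      by (metis (mono_tags, lifting) eventually_at_top_linorder gt_ex le_less_trans linorder_le_cases order_less_imp_le)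
    with neg[of x] show False by simp
  qed
  then obtain a where a: "a > X" "\<sigma> * (P a - 1) \<ge> 0" by blast
  \<comment> \<open>This side is invariant: the forcing has the sign \<open>\<sigma>\<close>, so the
    relaxation bound applies with \<open>c = 0\<close>.\<close>
  have P_side: "\<sigma> * (P x - 1) \<ge> 0" if "x \<ge> a" for x
  proof -
    have "\<sigma> * (P x - 1) \<ge> 0 + (\<sigma> * (P a - 1) - 0) * exp (- \<kappa> * (x - a))"
      using signed_exp_minus_one_ge[OF \<sigma>, of 0] sgn a par that
      by (intro relaxation_lower_bound[OF dP]) auto
    moreover have "(\<sigma> * (P a - 1) - 0) * exp (- \<kappa> * (x - a)) \<ge> 0" using a by (intro mult_nonneg_nonneg) auto
    ultimately show ?thesis by linarith
  qed
  have decr: "\<sigma> * w y \<le> \<sigma> * w x" if "a \<le> x" "x \<le> y" for x y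
  proof (rule DERIV_nonpos_imp_nonincreasing[OF that(2), where f = "\<lambda>x. \<sigma> * w x"])
    fix t assume "x \<le> t" "t \<le> y"
    then have "- \<theta> * (\<sigma> * (P t powr m - 1)) \<le> 0"
      using signed_powr_minus_one(1)[OF \<sigma> par(3) pos[of t]] P_side[of t] that par
      by (intro mult_nonpos_nonneg) auto
    with dsw[of t] show "\<exists>y. ((\<lambda>x. \<sigma> * w x) has_real_derivative y) (at t) \<and> y \<le> 0" by blast
  qed
  \<comment> \<open>Being nonincreasing and nonnegative, \<open>\<sigma> * w\<close> would vanish on
    a half-line after its first zero; then \<open>w' = 0\<close> forces \<open>P = 1\<close>,
    against \<open>ne\<close>.\<close>
  have wpos: "\<sigma> * w x > 0" if "x \<ge> a" for x
  proof (rule ccontr)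
    assume "\<not> ?thesis"
    then have z: "w y = 0" if "y \<ge> x" for y
      using decr[of x y] sgn[of y] a \<open>x \<ge> a\<close> that \<sigma> by auto
    have "(w has_real_derivative 0) (at (x + 1))"
      by (rule has_field_derivative_transform_within[of "\<lambda>_. 0" _ _ _ 1])
        (use z in \<open>auto simp: dist_real_def\<close>)
    then have "P (x+1) powr m = 1" using DERIV_unique[OF dw] par by fastforce
    then have "P (x+1) = 1" using pos[of "x+1"] par by (metis powr_eq_one_iff_gen less_irrefl)
    with ne[of "x+1"] z[of "x+1"] show False by simp
  qed
  have wsmall: "\<forall>\<^sub>F x in at_top. \<sigma> * w x < e" if "e > 0" for e
  proof -
    have "\<exists>x\<ge>a. \<sigma> * w x < e"
    proof (rule ccontr)
      assume "\<not> ?thesis"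
      then have big: "\<And>x. x \<ge> a \<Longrightarrow> \<sigma> * w x \<ge> e" by force
      \<comment> \<open>Half of the gap that \<open>P\<close> is guaranteed to approach while
        \<open>\<sigma> * w \<ge> e\<close>. Then \<open>\<sigma> * w\<close> falls at speed at
        least \<open>\<theta> * c\<close>; \<open>d < 1\<close> keeps the base
        \<open>1 + \<sigma> * d\<close> positive.\<close>
      define d where "d = (1 - exp (-e)) / 2"
      have d: "0 < d" "d < 1 - exp (-e)" "d < 1" using \<open>e > 0\<close> exp_gt_zero[of "-e"] by (auto simp: d_def simp del: exp_gt_zero)
      define c where "c = \<sigma> * ((1 + \<sigma> * d) powr m - 1)"
      have "\<sigma> * d > -1" using d \<sigma> by auto
      then have "c > 0" unfolding c_def
        by (subst signed_powr_minus_one(2)) (use \<sigma> par d in auto)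
      obtain b where b: "b \<ge> a" "\<And>x. x \<ge> b \<Longrightarrow> \<sigma> * (P x - 1) > d"
        using P_away[OF big d(2)] unfolding eventually_at_top_linorder
        by (metis linorder_le_cases order_trans)
      have Pc: "\<sigma> * (P x powr m - 1) \<ge> c" if "x \<ge> b" for x
        using \<sigma> b(2)[OF that] pos[of x] \<open>\<sigma> * d > -1\<close> par unfolding c_def
        by (elim disjE) (auto intro!: powr_mono2)
      \<comment> \<open>Long enough for the drift to consume \<open>\<sigma> * w b\<close> and one
        unit more.\<close>
      let ?t = "b + (\<sigma> * w b + 1) / (\<theta> * c)"
      have bt: "b \<le> ?t" using wpos[OF b(1)] \<open>c > 0\<close> par by auto
      have "\<sigma> * w ?t + \<theta> * c * ?t \<le> \<sigma> * w b + \<theta> * c * b"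
      proof (rule DERIV_nonpos_imp_nonincreasing[OF bt, where f = "\<lambda>x. \<sigma> * w x + \<theta> * c * x"])
        fix x assume "b \<le> x" "x \<le> ?t"
        have "((\<lambda>x. \<sigma> * w x + \<theta> * c * x) has_real_derivative - \<theta> * (\<sigma> * (P x powr m - 1)) + \<theta> * c) (at x)"
          using DERIV_add[OF dsw DERIV_cmult[OF DERIV_ident, of "\<theta> * c"]] by simp
        moreover have "- \<theta> * (\<sigma> * (P x powr m - 1)) + \<theta> * c \<le> 0"
          using mult_left_mono[OF Pc[OF \<open>b \<le> x\<close>], of \<theta>] par by simp
        ultimately show "\<exists>y. ((\<lambda>x. \<sigma> * w x + \<theta> * c * x) has_real_derivative y) (at x) \<and> y \<le> 0" by blast
      qed
      moreover have "\<theta> * c * ?t = \<theta> * c * b + \<sigma> * w b + 1"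
        using \<open>c > 0\<close> par by (simp add: field_simps)
      ultimately have "\<sigma> * w ?t \<le> -1" by linarith
      with wpos[of ?t] bt b show False by simp
    qed
    then show ?thesis unfolding eventually_at_top_linorder
      by (meson decr le_less_trans)
  qed
  have absw: "\<bar>w x\<bar> = \<sigma> * w x" if "x \<ge> a" for x using wpos[OF that] \<sigma> by auto
  have "\<forall>\<^sub>F x in at_top. \<bar>w x\<bar> < e" if "e > 0" for e
    using wsmall[OF that] eventually_ge_at_top[of a] by eventually_elim (simp add: absw)
  then have w0: "(w \<longlongrightarrow> 0) at_top" by (intro tendstoI) (auto simp: dist_real_def)
  have "\<forall>\<^sub>F x in at_top. \<bar>P x - 1\<bar> < e" if "e > 0" for e
  proof -
    \<comment> \<open>\<open>P_side\<close> bounds \<open>P - 1\<close> from one side only; the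
      other side is the relaxation bound with sign \<open>-\<sigma>\<close>, available because
      \<open>exp w\<close> tends to 1.\<close>
    have "((\<lambda>x. (-\<sigma>) * (exp (w x) - 1)) \<longlongrightarrow> (-\<sigma>) * (exp 0 - 1)) at_top"
      by (intro tendsto_intros w0)
    then have "\<forall>\<^sub>F x in at_top. (-\<sigma>) * (exp (w x) - 1) > - e / 2"
      by (rule order_tendstoD) (use \<open>e > 0\<close> in auto)
    then obtain b where b: "\<And>x. x \<ge> b \<Longrightarrow> (-\<sigma>) * (exp (w x) - 1) \<ge> - e / 2"
      unfolding eventually_at_top_linorder by (meson less_imp_le)
    have "\<forall>\<^sub>F x in at_top. (-\<sigma>) * (P x - 1) > - e"
      by (rule relaxation_eventually_ge[OF dP par(1) b]) (use \<open>e > 0\<close> in auto)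
    with eventually_ge_at_top[of a] show ?thesis
      by eventually_elim (use P_side \<sigma> in fastforce)
  qed
  then have P1: "(P \<longlongrightarrow> 1) at_top" by (intro tendstoI) (auto simp: dist_real_def)
  have "\<forall>\<^sub>F x in at_top. w x \<noteq> 0"
    using eventually_ge_at_top[of a] by eventually_elim (use wpos in force)
  from focus_no_sign_near_equilibrium[OF par dw dP w0 P1 this] show False .
qed

text \<open>Backward Gronwall estimate: the squared distance to the equilibrium times
  \<open>exp (C * x)\<close> is nondecreasing, so vanishing at \<open>b\<close> forces vanishing at
  every earlier point.\<close>

lemma equilibrium_unreachable:
  fixes w P :: "real \<Rightarrow> real" and \<kappa> \<theta> m x0 :: real
  assumes par: "\<kappa> > 0" "\<theta> > 0" "0 < m" "m \<le> 1"
    and dw: "\<And>x. (w has_real_derivative \<theta> * (1 - P x powr m)) (at x)"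
    and dP: "\<And>x. (P has_real_derivative \<kappa> * (exp (w x) - P x)) (at x)"
    and pos: "\<And>x. P x > 0" and eq: "w b = 0" "P b = 1" and "a \<le> b"
  shows "w a = 0"
proof -
  have "continuous_on {a..b} w"
    by (meson DERIV_continuous_on dw has_field_derivative_at_within)
  then obtain M where M: "\<And>x. x \<in> {a..b} \<Longrightarrow> w x \<le> M"
    using continuous_attains_sup[of "{a..b}" w] \<open>a \<le> b\<close> by (metis atLeastAtMost_iff compact_Icc empty_iff order_refl)
  \<comment> \<open>A Lipschitz constant for \<open>exp\<close> between 0 and \<open>w x\<close>;
    the absolute value makes it at least 1, as negative \<open>w x\<close> requires.\<close>
  define L where "L = exp \<bar>M\<bar>"
  have L: "L \<ge> 1" by (simp add: L_def)
  have expL: "\<bar>exp (w x) - 1\<bar> \<le> L * \<bar>w x\<bar>" if "x \<in> {a..b}" for x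
  proof (cases "w x \<ge> 0")
    case True
    have "exp (w x) * (1 + (- w x)) \<le> exp (w x) * exp (- w x)"
      by (intro mult_left_mono exp_ge_add_one_self) auto
    then have "exp (w x) - 1 \<le> exp (w x) * w x" by (simp add: exp_minus algebra_simps)
    also have "\<dots> \<le> L * w x" using M[OF that] True by (auto simp: L_def intro!: mult_right_mono)
    finally show ?thesis using True by simp
  next
    case False
    have "1 - exp (w x) \<le> 1 * \<bar>w x\<bar>" using exp_ge_add_one_self[of "w x"] False by linarith
    also have "\<dots> \<le> L * \<bar>w x\<bar>" using L by (intro mult_right_mono) auto
    finally show ?thesis using False by simp
  qed
  \<comment> \<open>Because \<open>m \<le> 1\<close>, the power \<open>p powr m\<close> lies between
    1 and \<open>p\<close>.\<close>
  have powL: "\<bar>p powr m - 1\<bar> \<le> \<bar>p - 1\<bar>" if "p > 0" for p :: real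
  proof (cases "p \<ge> 1")
    case True
    then have "p powr m \<le> p powr 1" "p powr m \<ge> 1"
      using par powr_mono[of m 1 p] by (simp_all add: ge_one_powr_ge_zero)
    then show ?thesis using True by simp
  next
    case False
    then have "p powr m \<ge> p powr 1" "p powr m \<le> 1" using par that powr_mono'[of m 1 p] by (simp_all add: powr_le1)
    then show ?thesis using False that by simp
  qed
  let ?N = "\<lambda>x. (w x)\<^sup>2 + (P x - 1)\<^sup>2"
  \<comment> \<open>The cross terms cost \<open>\<theta>\<close> and \<open>\<kappa> * L\<close>
    through \<open>2 * A \<le> N\<close>; the damping term of \<open>P\<close> costs
    \<open>2 * \<kappa>\<close>.\<close>
  define C where "C = \<theta> + \<kappa> * L + 2 * \<kappa>"
  have "?N a * exp (C * a) \<le> ?N b * exp (C * b)"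
  proof (rule DERIV_nonneg_imp_nondecreasing[OF \<open>a \<le> b\<close>, where f = "\<lambda>x. ?N x * exp (C * x)"])
    fix x assume x: "a \<le> x" "x \<le> b"
    let ?q = "P x - 1"
    let ?D = "2 * w x * (\<theta> * (1 - P x powr m)) + 2 * ?q * (\<kappa> * (exp (w x) - P x))"
    have "((\<lambda>x. ?N x * exp (C * x)) has_real_derivative (?D + C * ?N x) * exp (C * x)) (at x)"
      by (auto intro!: derivative_eq_intros dw dP simp: algebra_simps)
    moreover have "?D + C * ?N x \<ge> 0"
    proof -
      define A where "A = \<bar>w x\<bar> * \<bar>?q\<bar>"
      define N where "N = ?N x"
      have AN: "2 * A \<le> N" using sum_squares_bound[of "\<bar>w x\<bar>" "\<bar>?q\<bar>"] by (simp add: A_def N_def)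
      have "\<bar>w x * (P x powr m - 1)\<bar> \<le> A"
        using powL[OF pos[of x]] by (auto simp: abs_mult A_def intro!: mult_left_mono)
      then have "\<theta> * (w x * (P x powr m - 1)) \<le> \<theta> * A" using par by (intro mult_left_mono) auto
      moreover have "\<bar>?q * (exp (w x) - 1)\<bar> \<le> \<bar>?q\<bar> * (L * \<bar>w x\<bar>)"
        using expL[of x] x by (auto simp: abs_mult intro!: mult_left_mono)
      then have "- (?q * (exp (w x) - 1)) \<le> L * A" by (simp add: A_def mult_ac)
      then have "\<kappa> * (- (?q * (exp (w x) - 1))) \<le> \<kappa> * (L * A)" using par by (intro mult_left_mono) auto
      moreover have "\<theta> * (2 * A) \<le> \<theta> * N" "\<kappa> * L * (2 * A) \<le> \<kappa> * L * N"
        using par L AN by (auto intro!: mult_left_mono)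
      moreover have "2 * \<kappa> * ?q\<^sup>2 \<le> 2 * \<kappa> * N" using par by (intro mult_left_mono) (auto simp: N_def)
      moreover have "?D = - 2 * (\<theta> * (w x * (P x powr m - 1))) - 2 * (\<kappa> * (- (?q * (exp (w x) - 1)))) - 2 * \<kappa> * ?q\<^sup>2"
        by (simp add: algebra_simps power2_eq_square)
      moreover have "C * N = \<theta> * N + \<kappa> * L * N + 2 * \<kappa> * N" by (simp add: C_def algebra_simps)
      moreover have "\<theta> * (2 * A) = 2 * (\<theta> * A)" "\<kappa> * L * (2 * A) = 2 * (\<kappa> * (L * A))" by simp_all
      ultimately have "?D + C * N \<ge> 0" by linarith
      then show ?thesis by (simp only: N_def)
    qed
    then have "(?D + C * ?N x) * exp (C * x) \<ge> 0" by (intro mult_nonneg_nonneg) auto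
    ultimately show "\<exists>y. ((\<lambda>x. ?N x * exp (C * x)) has_real_derivative y) (at x) \<and> 0 \<le> y"
      by blast
  qed
  then have "?N a * exp (C * a) \<le> 0" using eq by simp
  then have "?N a \<le> 0" by (simp add: mult_le_0_iff)
  then show ?thesis by (simp add: sum_power2_le_zero_iff)
qed

section \<open>The inverse nonlinearity\<close>

lemma has_derivative_interior:
  fixes F :: "real \<Rightarrow> real"
  assumes "(F has_real_derivative D) (at x within {0..})" "x > 0"
  shows "(F has_real_derivative D) (at x)"
  using assms by (metis at_within_interior greaterThan_iff interior_real_atLeast)

lemma filterlim_shift:
  assumes "((\<lambda>t. h t / t) \<longlongrightarrow> (0::real)) at_top" shows "filterlim (\<lambda>t. t + h t) at_top at_top"
proof -
  have "((\<lambda>t. 1 + h t / t) \<longlongrightarrow> 1 + 0) at_top" by (intro tendsto_intros assms)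
  then have "filterlim (\<lambda>t. (1 + h t / t) * t) at_top at_top"
    by (intro filterlim_tendsto_pos_mult_at_top[OF _ _ filterlim_ident]) auto
  then show ?thesis
    by (rule filterlim_mono_eventually[OF _ order_refl order_refl])
      (use eventually_gt_at_top[of 0] in \<open>eventually_elim, simp add: field_simps\<close>)
qed

locale nonlinearity =
  fixes f :: "real \<Rightarrow> real"
  assumes A1: "A1 f" and A2: "A2 f" and A3: "A3 f" and A4: "A4 f" and A5: "A5 f"
begin

text \<open>Otherwise the simplifier rewrites \<open>gder 1 f\<close> to \<open>gder (Suc 0) f\<close>.\<close>

declare One_nat_def [simp del]

abbreviation "g \<equiv> ginv f"
abbreviation "g1 \<equiv> gder 1 f"
abbreviation "g2 \<equiv> gder 2 f"

section \<open>Monotonicity of \<open>f\<close> and differentiability of its inverse\<close>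

lemma f_derivatives:
  obtains f1 f2 where
    "\<And>x. x \<ge> 0 \<Longrightarrow> (f has_real_derivative f1 x) (at x within {0..})"
    "\<And>x. x \<ge> 0 \<Longrightarrow> (f1 has_real_derivative f2 x) (at x within {0..})"
    "\<And>x. x \<ge> 0 \<Longrightarrow> f1 x > 0"
proof -
  from A1 obtain F :: "nat \<Rightarrow> real \<Rightarrow> real" where F: "F 0 = f"
    "\<And>k x. k < 4 \<Longrightarrow> x \<ge> 0 \<Longrightarrow> (F k has_real_derivative F (Suc k) x) (at x within {0..})"
    "\<And>x. x \<ge> 0 \<Longrightarrow> F 1 x > 0" unfolding A1_def by auto
  show thesis using that[of "F 1" "F 2"] F(1,3) F(2)[of 0] F(2)[of 1]
    by (simp add: numeral_2_eq_2 One_nat_def)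
qed

lemma f_at_top: "filterlim f at_top at_top"
  using A1 by (simp add: A1_def)

lemma f_continuous: "continuous_on {0..} f"
proof -
  obtain f1 f2 where "\<And>x. x \<ge> 0 \<Longrightarrow> (f has_real_derivative f1 x) (at x within {0..})"
    using f_derivatives by metis
  then show ?thesis by (intro DERIV_continuous_on) auto
qed

lemma f_strict_mono: "0 \<le> x \<Longrightarrow> x < y \<Longrightarrow> f x < f y"
proof -
  assume xy: "0 \<le> x" "x < y"
  obtain f1 f2 where d: "\<And>x. x \<ge> 0 \<Longrightarrow> (f has_real_derivative f1 x) (at x within {0..})"
    and p: "\<And>x. x \<ge> 0 \<Longrightarrow> f1 x > 0" using f_derivatives by metis
  show "f x < f y"
  proof (rule DERIV_pos_imp_increasing_open[OF xy(2)])
    fix z assume "x < z" "z < y"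
    then have "z \<in> interior {0..}" using xy by (simp add: interior_real_atLeast)
    then show "\<exists>D. (f has_real_derivative D) (at z) \<and> D > 0"
      using d[of z] p[of z] xy \<open>x < z\<close> by (metis at_within_interior less_imp_le order_le_less_trans)
  qed (use continuous_on_subset[OF f_continuous] xy in auto)
qed

lemma f_mono: "0 \<le> x \<Longrightarrow> x \<le> y \<Longrightarrow> f x \<le> f y"
  using f_strict_mono[of x y] by (cases "x = y") auto

lemma g_f: "x \<ge> 0 \<Longrightarrow> g (f x) = x"
  unfolding ginv_def
  by (intro inv_into_f_f inj_onI) (auto, metis f_strict_mono linorder_cases less_irrefl)

lemma f_surj:
  assumes "t \<ge> f 0" obtains x where "x \<ge> 0" "f x = t"
proof -
  obtain b where b: "b \<ge> 0" "f b \<ge> t"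
    using f_at_top unfolding filterlim_at_top eventually_at_top_linorder by (metis linorder_le_cases)
  have "\<exists>x\<ge>0. x \<le> b \<and> f x = t"
    using b assms continuous_on_subset[OF f_continuous] by (intro IVT') auto
  then show thesis using that by blast
qed

lemma f_g: "t \<ge> f 0 \<Longrightarrow> f (g t) = t" and g_nonneg: "t \<ge> f 0 \<Longrightarrow> g t \<ge> 0"
  using f_surj g_f by metis+

lemma g_mono: "f 0 \<le> s \<Longrightarrow> s \<le> t \<Longrightarrow> g s \<le> g t"
  by (metis f_g f_strict_mono g_nonneg not_le order.trans)

lemma g_pos: "t > f 0 \<Longrightarrow> g t > 0"
  by (metis f_g g_nonneg less_eq_real_def less_irrefl)

text \<open>\<open>gder\<close> iterates \<open>deriv\<close> on an inverse that is meaningful only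
  from \<open>f 0\<close> on. On the open half-line above \<open>f 0\<close> the inverse function
  rule gives \<open>g1 = 1 / f1 (g t)\<close>, and this local identity can be differentiated
  again.\<close>

lemma g_derivatives:
  shows g_deriv: "t > f 0 \<Longrightarrow> (g has_real_derivative g1 t) (at t)"
    and g1_pos: "t > f 0 \<Longrightarrow> g1 t > 0"
    and g1_deriv: "t > f 0 \<Longrightarrow> (g1 has_real_derivative g2 t) (at t)"
proof -
  obtain f1 f2 where d: "\<And>x. x \<ge> 0 \<Longrightarrow> (f has_real_derivative f1 x) (at x within {0..})"
    and d1: "\<And>x. x \<ge> 0 \<Longrightarrow> (f1 has_real_derivative f2 x) (at x within {0..})"
    and p: "\<And>x. x \<ge> 0 \<Longrightarrow> f1 x > 0" using f_derivatives by metis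
  have g': "(g has_real_derivative inverse (f1 (g t))) (at t)" if "t > f 0" for t
  proof (rule DERIV_inverse_function[where f = f and a = "f 0" and b = "t + 1"])
    show "(f has_real_derivative f1 (g t)) (at (g t))"
      using has_derivative_interior d g_pos that by (meson less_imp_le)
    have "isCont g (f (g t))"
    proof (rule isCont_inverse_function[where f = f and x = "g t" and d = "g t / 2"])
      fix z assume "\<bar>z - g t\<bar> \<le> g t / 2"
      then have z: "z > 0" using g_pos[OF that] by linarith
      then show "g (f z) = z" by (simp add: g_f)
      show "isCont f z" using has_derivative_interior[OF d] z by (meson DERIV_isCont less_imp_le)
    qed (use g_pos that in auto)
    then show "isCont g t" using f_g that by simp
  qed (use that p[OF g_nonneg[of t]] f_g in auto)
  have g1: "g1 t = inverse (f1 (g t))" if "t > f 0" for t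
    using DERIV_imp_deriv[OF g'[OF that]] by (simp add: gder_def One_nat_def)
  show "t > f 0 \<Longrightarrow> (g has_real_derivative g1 t) (at t)" using g' g1 by simp
  show "t > f 0 \<Longrightarrow> g1 t > 0" using g1 p g_nonneg by simp
  assume t: "t > f 0"
  have "((\<lambda>t. inverse (f1 (g t))) has_real_derivative
      - (inverse (f1 (g t)) * (f2 (g t) * inverse (f1 (g t))) * inverse (f1 (g t)))) (at t)"
    using p[OF g_nonneg[of t]] t
    by (intro DERIV_inverse' DERIV_chain2[where f = f1 and g = g] g' has_derivative_interior d1 g_pos) (auto intro: g_nonneg)
  then have "(g1 has_real_derivative
      - (inverse (f1 (g t)) * (f2 (g t) * inverse (f1 (g t))) * inverse (f1 (g t)))) (at t)"
    by (rule has_field_derivative_transform_within_open[of _ _ _ "{f 0<..}"]) (use t g1 in auto)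
  moreover have "g2 t = deriv g1 t" by (simp add: gder_def numeral_2_eq_2 One_nat_def)
  ultimately show "(g1 has_real_derivative g2 t) (at t)" using DERIV_imp_deriv by metis
qed

section \<open>Slow variation of \<open>g1\<close> and its consequences\<close>

lemma eventually_g1_pos: "\<forall>\<^sub>F t in at_top. g1 t > 0"
  using eventually_gt_at_top[of "f 0"] by eventually_elim (rule g1_pos)

text \<open>Where \<open>g1 \<ge> 1/2\<close> this is (A2); where \<open>g1 < 1/2\<close> the logarithm in (A4) is bounded away from 0.\<close>

lemma g2_over_g1: "((\<lambda>t. g2 t / g1 t) \<longlongrightarrow> 0) at_top"
proof (rule tendstoI)
  fix e :: real assume "e > 0"
  have "\<forall>\<^sub>F t in at_top. \<bar>g2 t\<bar> < e / 2"
    using tendstoD[of g2 0 at_top "e / 2"] A2 \<open>e > 0\<close> by (simp add: A2_def dist_real_def)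
  moreover have "\<forall>\<^sub>F t in at_top. \<bar>g2 t / g1 t * ln (g1 t)\<bar> < e * ln 2"
    using tendstoD[of "\<lambda>t. g2 t / g1 t * ln (g1 t)" 0 at_top "e * ln 2"] A4 \<open>e > 0\<close>
    by (simp add: A4_def dist_real_def)
  ultimately show "\<forall>\<^sub>F t in at_top. dist (g2 t / g1 t) 0 < e"
    using eventually_g1_pos
  proof eventually_elim
    case (elim t)
    show ?case
    proof (cases "g1 t \<ge> 1 / 2")
      case True
      then have "\<bar>g2 t / g1 t\<bar> \<le> \<bar>g2 t\<bar> / (1 / 2)" unfolding abs_divide by (intro divide_left_mono) auto
      then show ?thesis using elim by simp
    next
      case False
      then have "ln (g1 t) \<le> ln (1 / 2)" using elim by (subst ln_le_cancel_iff) auto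
      then have "ln 2 \<le> \<bar>ln (g1 t)\<bar>" by (simp add: ln_div)
      then have "\<bar>g2 t / g1 t\<bar> * ln 2 \<le> \<bar>g2 t / g1 t\<bar> * \<bar>ln (g1 t)\<bar>" by (intro mult_left_mono) auto
      also have "\<dots> < e * ln 2" using elim by (simp add: abs_mult)
      finally have "\<bar>g2 t / g1 t\<bar> < e" by (simp only: mult_less_cancel_right_pos ln_gt_zero)
      then show ?thesis by simp
    qed
  qed
qed

text \<open>L'Hospital with \<open>(ln g1)' = g2 / g1\<close>. It makes shifts by multiples of
  \<open>ln (g1 t)\<close> admissible as the \<open>o(t)\<close> shifts in \<open>A3\<close> and
  \<open>A5\<close>.\<close>

lemma ln_g1_littleo: "((\<lambda>t. ln (g1 t) / t) \<longlongrightarrow> 0) at_top"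
proof (rule lhospital_at_top_at_top[where f' = "\<lambda>t. g2 t / g1 t" and g' = "\<lambda>_. 1"])
  show "\<forall>\<^sub>F t in at_top. ((\<lambda>t. ln (g1 t)) has_real_derivative g2 t / g1 t) (at t)"
    using eventually_gt_at_top[of "f 0"]
    by eventually_elim (auto intro!: derivative_eq_intros g1_deriv g1_pos)
qed (use g2_over_g1 in \<open>auto simp: filterlim_ident\<close>)

lemma g1_ratio:
  assumes "((\<lambda>t. h t / t) \<longlongrightarrow> 0) at_top"
  shows "((\<lambda>t. g1 (t + h t) / g1 t) \<longlongrightarrow> 1) at_top"
proof -
  have "((\<lambda>t. g1 t / g1 (t + h t)) \<longlongrightarrow> 1) at_top"
    using A3 assms by (simp add: A3_def littleo_t_def)
  from tendsto_inverse[OF this] show ?thesis by simp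
qed

text \<open>By the mean value theorem the increment is \<open>a * g1 (t + \<xi>)\<close> with
  \<open>\<xi>\<close> bounded, and a bounded shift does not change \<open>g1\<close>
  asymptotically.\<close>

lemma g_increment: "((\<lambda>t. (g (t + a) - g t) / g1 t) \<longlongrightarrow> a) at_top"
proof -
  have "\<exists>\<xi>. \<bar>\<xi>\<bar> \<le> \<bar>a\<bar> \<and> g (t + a) - g t = a * g1 (t + \<xi>)" if t: "t > f 0 + \<bar>a\<bar>" for t
  proof (cases a "0::real" rule: linorder_cases)
    case greater
    then obtain z where "t < z" "z < t + a" "g (t + a) - g t = (t + a - t) * g1 z"
      using MVT2[of t "t + a" g g1] g_deriv t by force
    then show ?thesis by (intro exI[of _ "z - t"]) auto
  next
    case less
    then obtain z where "t + a < z" "z < t" "g t - g (t + a) = (t - (t + a)) * g1 z"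
      using MVT2[of "t + a" t g g1] g_deriv t by force
    then show ?thesis by (intro exI[of _ "z - t"]) (auto simp: algebra_simps)
  qed auto
  then obtain \<xi> where \<xi>: "\<And>t. t > f 0 + \<bar>a\<bar> \<Longrightarrow> \<bar>\<xi> t\<bar> \<le> \<bar>a\<bar> \<and> g (t + a) - g t = a * g1 (t + \<xi> t)"
    by metis
  have "((\<lambda>t. \<xi> t / t) \<longlongrightarrow> 0) at_top"
  proof (rule Lim_null_comparison)
    show "\<forall>\<^sub>F t in at_top. norm (\<xi> t / t) \<le> \<bar>a\<bar> / t"
      using eventually_gt_at_top[of "f 0 + \<bar>a\<bar>"] eventually_gt_at_top[of 0]
      by eventually_elim (use \<xi> in \<open>auto intro!: divide_right_mono\<close>)
    show "((\<lambda>t. \<bar>a\<bar> / t) \<longlongrightarrow> 0) at_top"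
      by (intro tendsto_divide_0[OF tendsto_const] filterlim_at_top_imp_at_infinity filterlim_ident)
  qed
  from tendsto_mult[OF tendsto_const g1_ratio[OF this], of a]
  have "((\<lambda>t. a * (g1 (t + \<xi> t) / g1 t)) \<longlongrightarrow> a) at_top" by simp
  then show ?thesis
    by (rule Lim_transform_eventually)
      (use eventually_gt_at_top[of "f 0 + \<bar>a\<bar>"] in \<open>eventually_elim, use \<xi> in auto\<close>)
qed

text \<open>As \<open>g\<close> is nonnegative, \<open>g t\<close> is at least its increment over a
  window of length \<open>Z + 1\<close>, which is asymptotically \<open>(Z + 1) * g1 t\<close>. This
  ratio is the rescaled height of a regular solution above its zero.\<close>

lemma g_over_g1_at_top: "filterlim (\<lambda>t. g t / g1 t) at_top at_top"
  unfolding filterlim_at_top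
proof
  fix Z :: real
  have "\<forall>\<^sub>F t in at_top. (g (t + (- (Z + 1))) - g t) / g1 t < - Z"
    by (rule order_tendstoD[OF g_increment]) simp
  then show "\<forall>\<^sub>F t in at_top. Z \<le> g t / g1 t"
    using eventually_gt_at_top[of "f 0"] eventually_gt_at_top[of "f 0 + (Z + 1)"]
  proof eventually_elim
    case (elim t)
    then have "g (t + (- (Z + 1))) \<ge> 0" "g1 t > 0" by (auto intro: g_nonneg g1_pos)
    then have "(- g t) / g1 t \<le> (g (t + (- (Z + 1))) - g t) / g1 t"
      by (intro divide_right_mono) auto
    then show ?case using elim by linarith
  qed
qed

text \<open>Extends \<open>g_increment\<close> from constant to convergent shifts by squeezing
  \<open>S x\<close> between \<open>T x + b\<close> for constants \<open>b\<close> on either side of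
  \<open>w\<close>, using monotonicity of \<open>g\<close>.\<close>

lemma g_increment_tendsto:
  assumes T: "filterlim T at_top F" and S: "((\<lambda>x. S x - T x) \<longlongrightarrow> w) F"
  shows "((\<lambda>x. (g (S x) - g (T x)) / g1 (T x)) \<longlongrightarrow> w) F"
proof -
  note incr = filterlim_compose[OF g_increment T]
  have ev: "\<forall>\<^sub>F x in F. T x > c" for c using T by (simp add: filterlim_at_top_dense)
  show ?thesis
  proof (rule order_tendstoI)
    fix a assume "a < w"
    define b where "b = (a + w) / 2"
    have "a < b" "b < w" using \<open>a < w\<close> by (auto simp: b_def)
    have "\<forall>\<^sub>F x in F. a < (g (T x + b) - g (T x)) / g1 (T x)"
      by (rule order_tendstoD(1)[OF incr \<open>a < b\<close>])
    moreover have "\<forall>\<^sub>F x in F. b < S x - T x" by (rule order_tendstoD(1)[OF S \<open>b < w\<close>])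
    ultimately show "\<forall>\<^sub>F x in F. a < (g (S x) - g (T x)) / g1 (T x)"
      using ev[of "f 0"] ev[of "f 0 - b"]
    proof eventually_elim
      case (elim x)
      then have "(g (T x + b) - g (T x)) / g1 (T x) \<le> (g (S x) - g (T x)) / g1 (T x)"
        using g1_pos[of "T x"] by (intro divide_right_mono diff_right_mono g_mono) auto
      then show ?case using elim by linarith
    qed
  next
    fix a assume "w < a"
    define b where "b = (a + w) / 2"
    have "b < a" "w < b" using \<open>w < a\<close> by (auto simp: b_def)
    have "\<forall>\<^sub>F x in F. (g (T x + b) - g (T x)) / g1 (T x) < a"
      by (rule order_tendstoD(2)[OF incr \<open>b < a\<close>])
    moreover have "\<forall>\<^sub>F x in F. S x - T x < b" by (rule order_tendstoD(2)[OF S \<open>w < b\<close>])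
    \<comment> \<open>Needed only to keep \<open>S x\<close> above \<open>f 0\<close>, where
      \<open>g\<close> is known to be monotone.\<close>
    moreover have "\<forall>\<^sub>F x in F. w - 1 < S x - T x" by (rule order_tendstoD(1)[OF S]) simp
    ultimately show "\<forall>\<^sub>F x in F. (g (S x) - g (T x)) / g1 (T x) < a"
      using ev[of "f 0"] ev[of "f 0 - (w - 1)"]
    proof eventually_elim
      case (elim x)
      then have "(g (S x) - g (T x)) / g1 (T x) \<le> (g (T x + b) - g (T x)) / g1 (T x)"
        using g1_pos[of "T x"] by (intro divide_right_mono diff_right_mono g_mono) auto
      then show ?case using elim by linarith
    qed
  qed
qed

text \<open>The converse passage: compare \<open>u x\<close> with \<open>g (T x + a)\<close> and
  apply \<open>f\<close>. It replaces a linearisation of \<open>f\<close> and turns convergence of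
  rescaled solutions into convergence of their nonlinear terms.\<close>

lemma f_increment_tendsto:
  assumes T: "filterlim T at_top F" and u: "\<And>x. u x \<ge> 0"
    and lim: "((\<lambda>x. (u x - g (T x)) / g1 (T x)) \<longlongrightarrow> w) F"
  shows "((\<lambda>x. f (u x) - T x) \<longlongrightarrow> w) F"
proof (rule order_tendstoI)
  note incr = filterlim_compose[OF g_increment T]
  have ev: "\<forall>\<^sub>F x in F. T x > c" for c using T by (simp add: filterlim_at_top_dense)
  fix a assume "a < w"
  define b where "b = (a + w) / 2"
  have "a < b" "b < w" using \<open>a < w\<close> by (auto simp: b_def)
  have "\<forall>\<^sub>F x in F. (g (T x + a) - g (T x)) / g1 (T x) < b"
    by (rule order_tendstoD(2)[OF incr \<open>a < b\<close>])
  moreover have "\<forall>\<^sub>F x in F. b < (u x - g (T x)) / g1 (T x)" by (rule order_tendstoD(1)[OF lim \<open>b < w\<close>])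
  ultimately show "\<forall>\<^sub>F x in F. a < f (u x) - T x"
    using ev[of "f 0"] ev[of "f 0 - a"]
  proof eventually_elim
    case (elim x)
    then have "(g (T x + a) - g (T x)) / g1 (T x) < (u x - g (T x)) / g1 (T x)" by linarith
    then have "g (T x + a) < u x" using g1_pos[of "T x"] elim by (simp add: divide_less_cancel)
    then have "f (g (T x + a)) < f (u x)" using elim by (intro f_strict_mono g_nonneg) auto
    then show ?case using elim f_g[of "T x + a"] by simp
  qed
next
  note incr = filterlim_compose[OF g_increment T]
  have ev: "\<forall>\<^sub>F x in F. T x > c" for c using T by (simp add: filterlim_at_top_dense)
  fix a assume "w < a"
  define b where "b = (a + w) / 2"
  have "b < a" "w < b" using \<open>w < a\<close> by (auto simp: b_def)
  have "\<forall>\<^sub>F x in F. b < (g (T x + a) - g (T x)) / g1 (T x)"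
    by (rule order_tendstoD(1)[OF incr \<open>b < a\<close>])
  moreover have "\<forall>\<^sub>F x in F. (u x - g (T x)) / g1 (T x) < b" by (rule order_tendstoD(2)[OF lim \<open>w < b\<close>])
  ultimately show "\<forall>\<^sub>F x in F. f (u x) - T x < a"
    using ev[of "f 0"] ev[of "f 0 - a"]
  proof eventually_elim
    case (elim x)
    then have "(u x - g (T x)) / g1 (T x) < (g (T x + a) - g (T x)) / g1 (T x)" by linarith
    then have "u x < g (T x + a)" using g1_pos[of "T x"] elim by (simp add: divide_less_cancel)
    then have "f (u x) < f (g (T x + a))" using u by (intro f_strict_mono)
    then show ?case using elim f_g[of "T x + a"] by simp
  qed
qed

text \<open>Written through \<open>exp\<close> and \<open>ln\<close> so that positivity holds for
  every \<open>t\<close>, even where \<open>g1\<close> is not known to be positive.\<close>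

definition scale :: "real \<Rightarrow> real \<Rightarrow> real \<Rightarrow> real" where
  "scale \<beta> \<theta> t = exp (((\<beta> + 1) * ln (g1 t) - t) / \<theta>)"

lemma scale_tendsto_0:
  assumes "\<theta> > 0" shows "(scale \<beta> \<theta> \<longlongrightarrow> 0) at_top"
proof -
  have "((\<lambda>t. (\<beta> + 1) * (ln (g1 t) / t) - 1) \<longlongrightarrow> (\<beta> + 1) * 0 - 1) at_top"
    by (intro tendsto_intros ln_g1_littleo)
  then have "filterlim (\<lambda>t. ((\<beta> + 1) * (ln (g1 t) / t) - 1) * t) at_bot at_top"
    by (intro filterlim_tendsto_neg_mult_at_bot filterlim_ident) auto
  then have "filterlim (\<lambda>t. (\<beta> + 1) * ln (g1 t) - t) at_bot at_top"
    by (rule filterlim_mono_eventually[OF _ order_refl order_refl])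
      (use eventually_gt_at_top[of 0] in \<open>eventually_elim, simp add: field_simps\<close>)
  then have "filterlim (\<lambda>t. ((\<beta> + 1) * ln (g1 t) - t) * inverse \<theta>) at_bot at_top"
    using assms by (subst mult.commute, intro filterlim_tendsto_pos_mult_at_bot[OF tendsto_const]) auto
  then have "filterlim (\<lambda>t. ((\<beta> + 1) * ln (g1 t) - t) / \<theta>) at_bot at_top"
    by (simp add: divide_inverse)
  from filterlim_compose[OF exp_at_bot this] show ?thesis by (simp add: scale_def[abs_def])
qed

lemma scale_pos: "scale \<beta> \<theta> t > 0"
  by (simp add: scale_def)

lemma ln_scale: "\<theta> \<noteq> 0 \<Longrightarrow> \<theta> * ln (scale \<beta> \<theta> t) = (\<beta> + 1) * ln (g1 t) - t"
  by (simp add: scale_def)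

lemma littleo_shift: "((\<lambda>t. (c + a * ln (g1 t)) / t) \<longlongrightarrow> 0) at_top"
proof -
  have "((\<lambda>t. c / t + a * (ln (g1 t) / t)) \<longlongrightarrow> 0 + a * 0) at_top"
    by (intro tendsto_intros ln_g1_littleo tendsto_divide_0[OF tendsto_const]
        filterlim_at_top_imp_at_infinity filterlim_ident)
  then show ?thesis by (simp add: add_divide_distrib)
qed

text \<open>At the radius \<open>R t\<close> one has
  \<open>- \<theta> * ln (R t) = t + o(t)\<close>. The choice of \<open>scale\<close> cancels the
  \<open>(\<beta> + 1) * ln (g1 t)\<close> inside \<open>Zfun\<close>, leaving \<open>t\<close> plus
  a convergent term, to which \<open>g_increment_tendsto\<close> applies.\<close>

lemma singular_solution_rescaled:
  assumes A6: "A6 \<alpha> \<beta> \<gamma>" and v: "singular_sol_thm11 f \<alpha> \<beta> \<gamma> lam v" and "s > 0"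
  defines "\<theta> \<equiv> theta \<alpha> \<beta> \<gamma>"
  shows "((\<lambda>t. (v (scale \<beta> \<theta> t * s * lam powr (- 1 / \<theta>)) - g t) / g1 t)
    \<longlongrightarrow> ln (\<theta> powr (\<beta> + 1) * (\<alpha> - \<beta> - 1)) - \<theta> * ln s) at_top"
proof -
  have \<theta>: "\<theta> > 0" and \<beta>: "\<beta> \<ge> 0" using A6 by (auto simp: A6_def \<theta>_def)
  have lam: "lam > 0" using v by (simp add: singular_sol_thm11_def)
  define R where "R t = scale \<beta> \<theta> t * s * lam powr (- 1 / \<theta>)" for t
  \<comment> \<open>\<open>t + h t\<close> is the argument of \<open>g2\<close> in the error term,
    and \<open>t + k t\<close> is the \<open>\<tau>\<close> inside \<open>Zfun\<close>; both shifts
    are \<open>o(t)\<close>.\<close>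
  define h where "h t = (ln lam - \<theta> * ln s) + - (\<beta> + 1) * ln (g1 t)" for t
  define k where "k t = (ln (\<beta> + 1) - \<theta> * ln s) + - (\<beta> + 1) * ln (g1 t)" for t
  have R: "R t > 0" for t using \<open>s > 0\<close> lam by (simp add: R_def scale_pos)
  have lnR: "- \<theta> * ln (R t) = t + h t" for t
    using \<open>s > 0\<close> lam \<theta> ln_scale[of \<theta> \<beta> t] scale_pos[of \<beta> \<theta> t]
    by (simp add: R_def h_def ln_mult ln_powr algebra_simps)
  have "filterlim R (at_right 0) at_top"
  proof -
    have "((\<lambda>t. scale \<beta> \<theta> t * (s * lam powr (- 1 / \<theta>))) \<longlongrightarrow> 0 * (s * lam powr (- 1 / \<theta>))) at_top"
      by (intro tendsto_intros scale_tendsto_0 \<theta>)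
    then have "(R \<longlongrightarrow> 0) at_top" by (simp add: R_def[abs_def] mult.assoc)
    moreover have "R t \<noteq> 0" for t using R[of t] by simp
    ultimately show ?thesis using R by (simp add: filterlim_at)
  qed
  moreover obtain C where "\<forall>\<^sub>F r in at_right 0.
        \<bar>v r - g (Zfun f \<alpha> \<beta> \<gamma> lam r)\<bar> \<le> C * \<bar>g2 (ln (r powr (- \<theta>)))\<bar>"
    using v unfolding singular_sol_thm11_def \<theta>_def by blast
  ultimately have ev: "\<forall>\<^sub>F t in at_top.
        \<bar>v (R t) - g (Zfun f \<alpha> \<beta> \<gamma> lam (R t))\<bar> \<le> C * \<bar>g2 (ln (R t powr (- \<theta>)))\<bar>"
    by (rule eventually_compose_filterlim[rotated])
  have "littleo_t h" unfolding h_def littleo_t_def by (rule littleo_shift)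
  then have "bigO_top (\<lambda>t. g2 (t + h t)) g2" using A5 by (simp add: A5_def)
  then obtain C' where C': "\<forall>\<^sub>F t in at_top. \<bar>g2 (t + h t)\<bar> \<le> C' * \<bar>g2 t\<bar>"
    unfolding bigO_top_def by blast
  have err: "((\<lambda>t. (v (R t) - g (Zfun f \<alpha> \<beta> \<gamma> lam (R t))) / g1 t) \<longlongrightarrow> 0) at_top"
  proof (rule Lim_null_comparison)
    show "\<forall>\<^sub>F t in at_top. norm ((v (R t) - g (Zfun f \<alpha> \<beta> \<gamma> lam (R t))) / g1 t) \<le> \<bar>C\<bar> * (\<bar>C'\<bar> * \<bar>g2 t / g1 t\<bar>)"
      using ev C' eventually_g1_pos
    proof eventually_elim
      case (elim t)
      have "ln (R t powr (- \<theta>)) = t + h t" using R[of t] lnR[of t] by (simp add: ln_powr)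
      then have "\<bar>v (R t) - g (Zfun f \<alpha> \<beta> \<gamma> lam (R t))\<bar> \<le> C * \<bar>g2 (t + h t)\<bar>" using elim by simp
      also have "\<dots> \<le> \<bar>C\<bar> * \<bar>g2 (t + h t)\<bar>" by (intro mult_right_mono) auto
      also have "\<dots> \<le> \<bar>C\<bar> * (C' * \<bar>g2 t\<bar>)" using elim by (intro mult_left_mono) auto
      also have "\<dots> \<le> \<bar>C\<bar> * (\<bar>C'\<bar> * \<bar>g2 t\<bar>)" by (intro mult_left_mono mult_right_mono) auto
      finally show ?case using elim by (simp add: divide_right_mono)
    qed
    have "((\<lambda>t. \<bar>C\<bar> * (\<bar>C'\<bar> * \<bar>g2 t / g1 t\<bar>)) \<longlongrightarrow> \<bar>C\<bar> * (\<bar>C'\<bar> * \<bar>0\<bar>)) at_top"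
      by (intro tendsto_intros g2_over_g1)
    then show "((\<lambda>t. \<bar>C\<bar> * (\<bar>C'\<bar> * \<bar>g2 t / g1 t\<bar>)) \<longlongrightarrow> 0) at_top" by simp
  qed
  have k: "((\<lambda>t. k t / t) \<longlongrightarrow> 0) at_top" unfolding k_def by (rule littleo_shift)
  note \<tau>lim = filterlim_shift[OF k]
  \<comment> \<open>The relative size of the correction to \<open>g1\<close> inside the logarithm of
    \<open>Zfun\<close>; it tends to 1 by (A4).\<close>
  define E where "E \<tau> = 1 + (\<beta> + 1) * (g2 \<tau> / g1 \<tau> * ln (g1 \<tau>))" for \<tau>
  have "(E \<longlongrightarrow> 1 + (\<beta> + 1) * 0) at_top"
    unfolding E_def using A4 unfolding A4_def by (intro tendsto_intros)
  then have E: "((\<lambda>t. E (t + k t)) \<longlongrightarrow> 1) at_top" using filterlim_compose[OF _ \<tau>lim] by simp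
  define W where "W = ln (\<theta> powr (\<beta> + 1) * (\<alpha> - \<beta> - 1)) - \<theta> * ln s"
  have "((\<lambda>t. W + (\<beta> + 1) * (ln (g1 (t + k t) / g1 t) + ln (E (t + k t))))
      \<longlongrightarrow> W + (\<beta> + 1) * (ln 1 + ln 1)) at_top"
    by (intro tendsto_intros g1_ratio k E) auto
  moreover have "\<forall>\<^sub>F t in at_top. W + (\<beta> + 1) * (ln (g1 (t + k t) / g1 t) + ln (E (t + k t)))
      = Zfun f \<alpha> \<beta> \<gamma> lam (R t) - t"
    using eventually_g1_pos eventually_compose_filterlim[OF eventually_g1_pos \<tau>lim] order_tendstoD(1)[OF E zero_less_one]
  proof eventually_elim
    case (elim t)
    let ?\<tau> = "t + k t"
    have "ln ((\<beta> + 1) / (lam * R t powr \<theta>)) = ln (\<beta> + 1) - ln lam + (- \<theta> * ln (R t))"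
      using R[of t] lam \<beta> by (simp add: ln_div ln_mult ln_powr)
    also have "\<dots> = ?\<tau>" unfolding lnR by (simp add: h_def k_def)
    finally have \<tau>: "ln ((\<beta> + 1) / (lam * R t powr \<theta>)) = ?\<tau>" .
    have "g1 ?\<tau> + (\<beta> + 1) * g2 ?\<tau> * ln (g1 ?\<tau>) = g1 ?\<tau> * E ?\<tau>"
      using elim by (simp add: E_def field_simps)
    then have B: "ln (g1 ?\<tau> + (\<beta> + 1) * g2 ?\<tau> * ln (g1 ?\<tau>)) = ln (g1 ?\<tau>) + ln (E ?\<tau>)"
      using elim by (simp add: ln_mult)
    have "Zfun f \<alpha> \<beta> \<gamma> lam (R t) = ln (\<theta> powr (\<beta> + 1) * (\<alpha> - \<beta> - 1)) - ln lam + (- \<theta> * ln (R t))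
        + (\<beta> + 1) * (ln (g1 ?\<tau>) + ln (E ?\<tau>))"
      unfolding Zfun_def Let_def \<theta>_def[symmetric] \<tau> B by simp
    also have "\<dots> - t = W + (\<beta> + 1) * (ln (g1 ?\<tau> / g1 t) + ln (E ?\<tau>))"
      unfolding lnR using elim by (simp add: W_def h_def ln_div algebra_simps)
    finally show ?case by simp
  qed
  ultimately have "((\<lambda>t. Zfun f \<alpha> \<beta> \<gamma> lam (R t) - t) \<longlongrightarrow> W) at_top"
    by (simp add: tendsto_cong)
  from g_increment_tendsto[OF filterlim_ident this] err
  have "((\<lambda>t. (v (R t) - g (Zfun f \<alpha> \<beta> \<gamma> lam (R t))) / g1 t
      + (g (Zfun f \<alpha> \<beta> \<gamma> lam (R t)) - g t) / g1 t) \<longlongrightarrow> 0 + W) at_top"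
    by (intro tendsto_add)
  then show ?thesis by (simp add: R_def W_def flip: add_divide_distrib)
qed

end

section \<open>The Gelfand equation\<close>

text \<open>The integrands below may blow up at 0, where \<open>\<gamma>\<close> or the exponent of
  the slope is negative; domination by an integrable power on the open interval is enough.\<close>

lemma integrable_from_0_powr_bound:
  fixes \<phi> :: "real \<Rightarrow> real"
  assumes "continuous_on {0<..} \<phi>" "\<And>x. x > 0 \<Longrightarrow> \<bar>\<phi> x\<bar> \<le> c * x powr a" "a > -1"
  shows "\<phi> integrable_on {0..s}"
proof (cases "s \<ge> 0")
  case True
  have pow: "(\<lambda>x. c * x powr a) integrable_on {0..s}"
    using True assms(3) by (intro integrable_on_mult_right integrable_on_powr_from_0)
  have "\<phi> integrable_on {0<..<s}"
  proof (rule measurable_bounded_by_integrable_imp_integrable)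
    show "\<phi> \<in> borel_measurable (lebesgue_on {0<..<s})"
      by (intro continuous_imp_measurable_on_sets_lebesgue continuous_on_subset[OF assms(1)]) auto
    show "(\<lambda>x. c * x powr a) integrable_on {0<..<s}"
      using pow by (simp add: integrable_on_Icc_iff_Ioo)
  qed (use assms(2) in auto)
  then show ?thesis by (simp add: integrable_on_Icc_iff_Ioo)
qed (simp add: integrable_on_empty)

lemma integral_from_0_has_derivative:
  fixes \<phi> :: "real \<Rightarrow> real"
  assumes "continuous_on {0<..} \<phi>" "\<And>x. x > 0 \<Longrightarrow> \<bar>\<phi> x\<bar> \<le> c * x powr a" "a > -1" "s > 0"
  shows "((\<lambda>s. integral {0..s} \<phi>) has_real_derivative \<phi> s) (at s)"
proof -
  \<comment> \<open>Splitting at \<open>s/2\<close> keeps the fundamental theorem away from the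
    singular endpoint.\<close>
  have "((\<lambda>x. integral {s/2..x} \<phi>) has_real_derivative \<phi> s) (at s within {s/2..s+1})"
    using assms(4) by (intro integral_has_real_derivative continuous_on_subset[OF assms(1)]) auto
  moreover have "at s within {s/2..s+1} = at s"
    using assms(4) by (intro at_within_interior) auto
  ultimately have "((\<lambda>x. integral {0..s/2} \<phi> + integral {s/2..x} \<phi>) has_real_derivative \<phi> s) (at s)"
    using DERIV_add[OF DERIV_const] by fastforce
  then show ?thesis
  proof (rule has_field_derivative_transform_within_open[where S = "{s/2<..}"])
    fix x assume "x \<in> {s/2<..}"
    then show "integral {0..s/2} \<phi> + integral {s/2..x} \<phi> = integral {0..x} \<phi>"
      using assms(4) by (intro Henstock_Kurzweil_Integration.integral_combine
        integrable_from_0_powr_bound[OF assms(1-3)]) auto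
  qed (use assms(4) in auto)
qed

text \<open>Minus the flux \<open>s powr \<alpha> * \<bar>z'\<bar> powr \<beta> * z'\<close> of the
  regular solution of \<open>L(z) + exp y = 0\<close>; \<open>slope\<close> below solves this
  relation for \<open>- z'\<close>.\<close>

definition mass :: "real \<Rightarrow> (real \<Rightarrow> real) \<Rightarrow> real \<Rightarrow> real" where
  "mass \<gamma> y s = integral {0..s} (\<lambda>x. x powr \<gamma> * exp (y x))"

definition slope :: "real \<Rightarrow> real \<Rightarrow> real \<Rightarrow> (real \<Rightarrow> real) \<Rightarrow> real \<Rightarrow> real" where
  "slope \<alpha> \<beta> \<gamma> y s = (s powr (- \<alpha>) * mass \<gamma> y s) powr (1 / (\<beta> + 1))"

text \<open>The regular solution of \<open>L(z) + exp y = 0\<close>, \<open>z(0) = 0\<close>, with the right-hand side \<open>y\<close> frozen.\<close>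

definition frozen_sol :: "real \<Rightarrow> real \<Rightarrow> real \<Rightarrow> (real \<Rightarrow> real) \<Rightarrow> real \<Rightarrow> real" where
  "frozen_sol \<alpha> \<beta> \<gamma> y s = - integral {0..s} (slope \<alpha> \<beta> \<gamma> y)"

locale exponents =
  fixes \<alpha> \<beta> \<gamma> :: real
  assumes A6: "A6 \<alpha> \<beta> \<gamma>"
begin

abbreviation "\<theta> \<equiv> theta \<alpha> \<beta> \<gamma>"
abbreviation "\<kappa> \<equiv> \<alpha> - \<beta> - 1"
abbreviation "m \<equiv> 1 / (\<beta> + 1)"

text \<open>The bound on \<open>\<gamma>\<close>, which makes \<open>s powr \<gamma>\<close>
  integrable at 0, comes from \<open>\<gamma> + 1 = \<theta> + \<kappa>\<close>.\<close>

lemma exponents_pos: "\<kappa> > 0" "\<theta> > 0" "\<beta> \<ge> 0" "\<gamma> > -1" "m > 0" "m \<le> 1"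
  using A6 by (auto simp: A6_def theta_def)

definition barrier :: "real \<Rightarrow> real" where
  "barrier s = (1 / (\<gamma> + 1)) powr m * s powr (\<theta> * m) / (\<theta> * m)"

lemma barrier_mono: "0 \<le> a \<Longrightarrow> a \<le> b \<Longrightarrow> barrier a \<le> barrier b"
  using exponents_pos unfolding barrier_def
  by (intro divide_right_mono mult_left_mono powr_mono2) auto

lemma barrier_nonneg: "barrier s \<ge> 0"
  using exponents_pos unfolding barrier_def by (intro divide_nonneg_nonneg mult_nonneg_nonneg) auto

lemma barrier_continuous: "continuous_on {0..} barrier"
  using exponents_pos unfolding barrier_def by (intro continuous_intros continuous_on_powr') auto

section \<open>Estimates for frozen solutions, uniform in the nonpositive right-hand side\<close>

context
  fixes y :: "real \<Rightarrow> real"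
  assumes y: "continuous_on {0..} y" and y_nonpos: "\<And>s. s \<ge> 0 \<Longrightarrow> y s \<le> 0"
begin

lemma mass_integrand:
  "continuous_on {0<..} (\<lambda>x. x powr \<gamma> * exp (y x))"
  "x > 0 \<Longrightarrow> \<bar>x powr \<gamma> * exp (y x)\<bar> \<le> 1 * x powr \<gamma>"
proof -
  show "continuous_on {0<..} (\<lambda>x. x powr \<gamma> * exp (y x))"
    by (intro continuous_intros continuous_on_subset[OF y]) auto
  show "x > 0 \<Longrightarrow> \<bar>x powr \<gamma> * exp (y x)\<bar> \<le> 1 * x powr \<gamma>"
    using y_nonpos[of x] by (simp add: abs_mult mult_left_le)
qed

lemma mass_integrable: "(\<lambda>x. x powr \<gamma> * exp (y x)) integrable_on {0..s}"
  using exponents_pos by (intro integrable_from_0_powr_bound[OF mass_integrand])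

lemma mass_deriv: "s > 0 \<Longrightarrow> (mass \<gamma> y has_real_derivative s powr \<gamma> * exp (y s)) (at s)"
  unfolding mass_def[abs_def] using exponents_pos
  by (intro integral_from_0_has_derivative[OF mass_integrand])

lemma mass_nonneg: "mass \<gamma> y s \<ge> 0"
  unfolding mass_def by (intro integral_nonneg mass_integrable) auto

lemma mass_le:
  assumes "s \<ge> 0" shows "mass \<gamma> y s \<le> s powr (\<gamma> + 1) / (\<gamma> + 1)"
proof -
  have "mass \<gamma> y s \<le> integral {0..s} (\<lambda>x. x powr \<gamma>)"
    unfolding mass_def using exponents_pos assms y_nonpos
    by (intro integral_le mass_integrable integrable_on_powr_from_0) (auto simp: mult_left_le)
  also have "\<dots> = s powr (\<gamma> + 1) / (\<gamma> + 1)"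
    using exponents_pos assms by (intro integral_unique has_integral_powr_from_0) auto
  finally show ?thesis .
qed

lemma mass_pos:
  assumes "s > 0" shows "mass \<gamma> y s > 0"
proof -
  have "mass \<gamma> y (s / 2) < mass \<gamma> y s"
  proof (rule DERIV_pos_imp_increasing[where f = "mass \<gamma> y"])
    fix x assume "s / 2 \<le> x" "x \<le> s"
    then show "\<exists>D. (mass \<gamma> y has_real_derivative D) (at x) \<and> D > 0"
      using mass_deriv[of x] assms by (intro exI[of _ "x powr \<gamma> * exp (y x)"]) auto
  qed (use assms in auto)
  with mass_nonneg[of "s / 2"] show ?thesis by linarith
qed

lemma slope_continuous: "continuous_on {0<..} (slope \<alpha> \<beta> \<gamma> y)"
proof -
  have m: "continuous_on {0<..} (mass \<gamma> y)"
    by (rule DERIV_continuous_on[OF has_field_derivative_at_within[OF mass_deriv]]) simp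
  have base: "s powr (- \<alpha>) * mass \<gamma> y s \<noteq> 0" if "s \<in> {0<..}" for s
    using mass_pos[of s] that by simp
  have "continuous_on {0<..} (\<lambda>s. s powr (- \<alpha>) * mass \<gamma> y s)"
    by (rule continuous_on_mult[OF continuous_on_powr[OF continuous_on_id continuous_on_const] m]) auto
  then show ?thesis
    unfolding slope_def[abs_def]
    by (rule continuous_on_powr[OF _ continuous_on_const]) (use base in blast)
qed

lemma slope_nonneg: "slope \<alpha> \<beta> \<gamma> y s \<ge> 0"
  by (simp add: slope_def)

lemma slope_le:
  assumes "s > 0" shows "slope \<alpha> \<beta> \<gamma> y s \<le> (1 / (\<gamma> + 1)) powr m * s powr (\<theta> * m - 1)"
proof -
  have "s powr (- \<alpha>) * mass \<gamma> y s \<le> s powr (- \<alpha>) * (s powr (\<gamma> + 1) / (\<gamma> + 1))"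
    using assms mass_le[of s] by (intro mult_left_mono) auto
  also have "\<dots> = 1 / (\<gamma> + 1) * s powr (- \<alpha> + (\<gamma> + 1))"
    unfolding powr_add[of s "- \<alpha>" "\<gamma> + 1"] by simp
  finally have "slope \<alpha> \<beta> \<gamma> y s \<le> (1 / (\<gamma> + 1) * s powr (- \<alpha> + (\<gamma> + 1))) powr m"
    unfolding slope_def using exponents_pos mass_nonneg[of s] by (intro powr_mono2) auto
  also have "\<dots> = (1 / (\<gamma> + 1)) powr m * s powr ((- \<alpha> + (\<gamma> + 1)) * m)"
    using exponents_pos by (simp only: powr_mult powr_powr) 
  also have "(- \<alpha> + (\<gamma> + 1)) * m = \<theta> * m - 1"
    using exponents_pos by (simp add: theta_def field_simps)
  finally show ?thesis .
qed

lemma slope_bound: "s > 0 \<Longrightarrow> \<bar>slope \<alpha> \<beta> \<gamma> y s\<bar> \<le> (1 / (\<gamma> + 1)) powr m * s powr (\<theta> * m - 1)"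
  using slope_le slope_nonneg by simp

lemma slope_exponent: "\<theta> * m - 1 > - 1"
  using exponents_pos by simp

lemma slope_integrable: "slope \<alpha> \<beta> \<gamma> y integrable_on {0..s}"
  by (intro integrable_from_0_powr_bound[OF slope_continuous slope_bound slope_exponent])

lemma frozen_sol_deriv:
  "s > 0 \<Longrightarrow> (frozen_sol \<alpha> \<beta> \<gamma> y has_real_derivative - slope \<alpha> \<beta> \<gamma> y s) (at s)"
  unfolding frozen_sol_def[abs_def]
  by (intro DERIV_minus integral_from_0_has_derivative[OF slope_continuous slope_bound slope_exponent])

lemma frozen_sol_0: "frozen_sol \<alpha> \<beta> \<gamma> y 0 = 0"
  by (simp add: frozen_sol_def)

text \<open>Integrates the pointwise slope bound. The increments of \<open>barrier\<close> serve as
  a modulus of continuity common to all \<open>y\<close>, which is the equicontinuity behind the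
  compactness argument.\<close>

lemma frozen_sol_increment:
  assumes "0 \<le> a" "a \<le> b"
  shows "\<bar>frozen_sol \<alpha> \<beta> \<gamma> y a - frozen_sol \<alpha> \<beta> \<gamma> y b\<bar> \<le> barrier b - barrier a"
proof -
  let ?I = "\<lambda>s. integral {0..s} (slope \<alpha> \<beta> \<gamma> y)"
  let ?p = "\<lambda>s. (1 / (\<gamma> + 1)) powr m * s powr (\<theta> * m - 1)"
  have p: "(?p has_integral barrier s) {0..s}" if "s \<ge> 0" for s
    using has_integral_mult_right[OF has_integral_powr_from_0[OF slope_exponent that], of "(1 / (\<gamma> + 1)) powr m"]
    by (simp add: barrier_def mult.assoc)
  then have pint: "?p integrable_on {0..s}" if "s \<ge> 0" for s using that by blast
  have slope_ab: "slope \<alpha> \<beta> \<gamma> y integrable_on {a..b}" "?p integrable_on {a..b}"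
    by (rule integrable_subinterval_real[OF slope_integrable[of b]] integrable_subinterval_real[OF pint[of b]];
        use assms in auto)+
  have "?I b = ?I a + integral {a..b} (slope \<alpha> \<beta> \<gamma> y)"
    using assms slope_integrable by (intro Henstock_Kurzweil_Integration.integral_combine[symmetric]) auto
  moreover have "integral {a..b} (slope \<alpha> \<beta> \<gamma> y) \<ge> 0"
    by (intro integral_nonneg slope_ab slope_nonneg)
  moreover have "integral {a..b} (slope \<alpha> \<beta> \<gamma> y) \<le> integral {a..b} ?p"
  proof (rule integral_le[OF slope_ab])
    fix x assume "x \<in> {a..b}"
    \<comment> \<open>At \<open>x = 0\<close> both sides are 0, because \<open>0 powr a = 0\<close>
      for every exponent.\<close>
    then show "slope \<alpha> \<beta> \<gamma> y x \<le> ?p x"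
      using slope_le[of x] assms by (cases "x = 0") (auto simp: slope_def)
  qed
  moreover have "integral {0..b} ?p = integral {0..a} ?p + integral {a..b} ?p"
    using assms pint by (intro Henstock_Kurzweil_Integration.integral_combine[symmetric]) auto
  then have "barrier b = barrier a + integral {a..b} ?p"
    using integral_unique[OF p, of a] integral_unique[OF p, of b] assms by simp
  ultimately show ?thesis by (simp add: frozen_sol_def)
qed

lemma frozen_sol_nonpos: "frozen_sol \<alpha> \<beta> \<gamma> y s \<le> 0"
  unfolding frozen_sol_def using integral_nonneg[OF slope_integrable slope_nonneg] by simp

lemma frozen_sol_ge: "s \<ge> 0 \<Longrightarrow> frozen_sol \<alpha> \<beta> \<gamma> y s \<ge> - barrier s"
  using frozen_sol_increment[of 0 s] frozen_sol_0 exponents_pos by (simp add: barrier_def)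

end

text \<open>Dominated convergence twice, first in \<open>mass\<close> and then in the integral of
  \<open>slope\<close>; nonpositivity of \<open>y n\<close> supplies both majorants.\<close>

lemma frozen_sol_tendsto:
  assumes y: "\<And>n. continuous_on {0..} (y n)" "\<And>n s. s \<ge> 0 \<Longrightarrow> y n s \<le> 0"
    and lim: "\<And>s. s > 0 \<Longrightarrow> (\<lambda>n. y n s) \<longlonglongrightarrow> Z s"
    and Z: "continuous_on {0..} Z" "\<And>s. s \<ge> 0 \<Longrightarrow> Z s \<le> 0"
  shows "(\<lambda>n. frozen_sol \<alpha> \<beta> \<gamma> (y n) s) \<longlonglongrightarrow> frozen_sol \<alpha> \<beta> \<gamma> Z s"
proof (cases "s \<ge> 0")
  case True
  have mass_lim: "(\<lambda>n. mass \<gamma> (y n) x) \<longlonglongrightarrow> mass \<gamma> Z x" if "x \<ge> 0" for x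
    unfolding mass_def
  proof (rule dominated_convergence(2)[where h = "\<lambda>x. x powr \<gamma>"])
    show "(\<lambda>\<xi>. \<xi> powr \<gamma> * exp (y n \<xi>)) integrable_on {0..x}" for n
      using mass_integrable[OF y] .
    show "(\<lambda>\<xi>. \<xi> powr \<gamma>) integrable_on {0..x}"
      using exponents_pos that by (intro integrable_on_powr_from_0) auto
    show "norm (\<xi> powr \<gamma> * exp (y n \<xi>)) \<le> \<xi> powr \<gamma>" if "\<xi> \<in> {0..x}" for n \<xi>
      using y(2)[of \<xi> n] that by (simp add: abs_mult mult_left_le)
    show "(\<lambda>n. \<xi> powr \<gamma> * exp (y n \<xi>)) \<longlonglongrightarrow> \<xi> powr \<gamma> * exp (Z \<xi>)" if "\<xi> \<in> {0..x}" for \<xi>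
      using that by (cases "\<xi> = 0") (auto intro!: tendsto_intros lim)
  qed
  have "(\<lambda>n. integral {0..s} (slope \<alpha> \<beta> \<gamma> (y n))) \<longlonglongrightarrow> integral {0..s} (slope \<alpha> \<beta> \<gamma> Z)"
  proof (rule dominated_convergence(2)[where h = "\<lambda>x. (1 / (\<gamma> + 1)) powr m * x powr (\<theta> * m - 1)"])
    show "slope \<alpha> \<beta> \<gamma> (y n) integrable_on {0..s}" for n using slope_integrable[OF y] .
    show "(\<lambda>x. (1 / (\<gamma> + 1)) powr m * x powr (\<theta> * m - 1)) integrable_on {0..s}"
      using exponents_pos True by (intro integrable_on_mult_right integrable_on_powr_from_0) auto
    show "norm (slope \<alpha> \<beta> \<gamma> (y n) x) \<le> (1 / (\<gamma> + 1)) powr m * x powr (\<theta> * m - 1)"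
      if "x \<in> {0..s}" for n x
      using slope_bound[OF y, of x n] that by (cases "x = 0") (auto simp: slope_def)
    show "(\<lambda>n. slope \<alpha> \<beta> \<gamma> (y n) x) \<longlonglongrightarrow> slope \<alpha> \<beta> \<gamma> Z x" if "x \<in> {0..s}" for x
    proof (cases "x = 0")
      case False
      then have "x powr (- \<alpha>) * mass \<gamma> Z x \<noteq> 0" using mass_pos[OF Z, of x] that by auto
      then show ?thesis unfolding slope_def using that
        by (intro tendsto_powr tendsto_intros mass_lim) auto
    qed (simp add: slope_def)
  qed
  then show ?thesis unfolding frozen_sol_def by (intro tendsto_minus)
qed (simp add: frozen_sol_def)

text \<open>An Arzela-Ascoli argument with pointwise limits. The assumption \<open>transfer\<close>
  closes the loop: the right-hand sides converge to the same limit as their frozen solutions, so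
  that limit is a fixed point.\<close>

lemma frozen_sol_compactness:
  assumes y: "\<And>n. continuous_on {0..} (y n)" "\<And>n s. s \<ge> 0 \<Longrightarrow> y n s \<le> 0"
    and transfer: "\<And>s k l. s > 0 \<Longrightarrow> strict_mono k \<Longrightarrow> (\<lambda>n. frozen_sol \<alpha> \<beta> \<gamma> (y (k n)) s) \<longlonglongrightarrow> l \<Longrightarrow>
      (\<lambda>n. y (k n) s) \<longlonglongrightarrow> l"
  obtains k :: "nat \<Rightarrow> nat" and Z where "strict_mono k" "continuous_on {0..} Z" "\<And>s. s \<ge> 0 \<Longrightarrow> Z s \<le> 0"
    "\<And>s. s \<ge> 0 \<Longrightarrow> Z s = frozen_sol \<alpha> \<beta> \<gamma> Z s"
    "\<And>s. s \<ge> 0 \<Longrightarrow> (\<lambda>n. frozen_sol \<alpha> \<beta> \<gamma> (y (k n)) s) \<longlonglongrightarrow> Z s"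
proof -
  let ?z = "\<lambda>n. frozen_sol \<alpha> \<beta> \<gamma> (y n)"
  have bnd: "\<bar>?z n s\<bar> \<le> barrier s" if "s \<ge> 0" for n s
    using frozen_sol_nonpos[OF y, of n s] frozen_sol_ge[OF y that, of n] by simp
  define S where "S = (\<rat> \<inter> {0..} :: real set)"
  have "countable S" unfolding S_def using countable_rat by blast
  \<comment> \<open>The diagonal extraction needs one bound for all points, hence the normalisation
    by a factor that is never zero.\<close>
  moreover have "norm (?z n s / (1 + barrier s)) \<le> 1" if "s \<in> S" for n s
    using bnd[of s n] barrier_nonneg[of s] that by (simp add: S_def)
  ultimately obtain k :: "nat \<Rightarrow> nat" where k: "strict_mono k"
    "\<And>s. s \<in> S \<Longrightarrow> \<exists>l. (\<lambda>n. ?z (k n) s / (1 + barrier s)) \<longlonglongrightarrow> l"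
    using function_convergent_subsequence[of S "\<lambda>n s. ?z n s / (1 + barrier s)" 1] by metis
  have conv_S: "Cauchy (\<lambda>n. ?z (k n) s)" if s: "s \<in> S" for s
  proof -
    obtain l where "(\<lambda>n. ?z (k n) s / (1 + barrier s)) \<longlonglongrightarrow> l" using k(2)[OF s] by blast
    from tendsto_mult_right[OF this, of "1 + barrier s"]
    have "(\<lambda>n. ?z (k n) s) \<longlonglongrightarrow> l * (1 + barrier s)"
      using barrier_nonneg[of s] by (simp add: add_nonneg_eq_0_iff)
    then show ?thesis using LIMSEQ_imp_Cauchy by blast
  qed
  have "\<exists>l. (\<lambda>n. ?z (k n) s) \<longlonglongrightarrow> l" if "s \<ge> 0" for s
  proof -
    have "Cauchy (\<lambda>n. ?z (k n) s)"
    proof (rule metric_CauchyI)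
      fix e :: real assume "e > 0"
      have "continuous (at s within {0..}) barrier"
        using barrier_continuous that by (simp add: continuous_on_eq_continuous_within)
      then obtain d where d: "d > 0" "\<And>q. q \<ge> 0 \<Longrightarrow> dist q s < d \<Longrightarrow> dist (barrier q) (barrier s) < e / 3"
        using \<open>e > 0\<close> unfolding continuous_within_eps_delta
        by (metis atLeast_iff divide_pos_pos zero_less_numeral)
      obtain q where q: "q \<in> \<rat>" "s < q" "q < s + d" using Rats_dense_in_real[of s "s + d"] d by auto
      \<comment> \<open>Uniform in \<open>n\<close>, so Cauchy convergence at the rational point
        \<open>q\<close> carries over to \<open>s\<close>.\<close>
      have close: "\<bar>?z n s - ?z n q\<bar> < e / 3" for n
        using frozen_sol_increment[OF y, of s q n] d(2)[of q] q that by (auto simp: dist_real_def)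
      have "q \<in> S" using q that by (simp add: S_def)
      from metric_CauchyD[OF conv_S[OF this], of "e / 3"] \<open>e > 0\<close>
      obtain M where M: "\<And>i j. i \<ge> M \<Longrightarrow> j \<ge> M \<Longrightarrow> dist (?z (k i) q) (?z (k j) q) < e / 3" by auto
      have "dist (?z (k i) s) (?z (k j) s) < e" if "i \<ge> M" "j \<ge> M" for i j
        using M[OF that] close[of "k i"] close[of "k j"] unfolding dist_real_def by linarith
      then show "\<exists>M. \<forall>i\<ge>M. \<forall>j\<ge>M. dist (?z (k i) s) (?z (k j) s) < e" by blast
    qed
    then show ?thesis using Cauchy_convergent_iff convergent_def by blast
  qed
  then obtain Z where Z: "\<And>s. s \<ge> 0 \<Longrightarrow> (\<lambda>n. ?z (k n) s) \<longlonglongrightarrow> Z s" by metis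
  have Z_inc: "\<bar>Z a - Z b\<bar> \<le> barrier b - barrier a" if "0 \<le> a" "a \<le> b" for a b
  proof (rule LIMSEQ_le_const2)
    show "(\<lambda>n. \<bar>?z (k n) a - ?z (k n) b\<bar>) \<longlonglongrightarrow> \<bar>Z a - Z b\<bar>"
      using that by (intro tendsto_intros Z) auto
    show "\<exists>N. \<forall>n\<ge>N. \<bar>?z (k n) a - ?z (k n) b\<bar> \<le> barrier b - barrier a"
      using frozen_sol_increment[OF y that] by blast
  qed
  have Z_inc': "\<bar>Z a - Z b\<bar> \<le> \<bar>barrier a - barrier b\<bar>" if "0 \<le> a" "0 \<le> b" for a b
    using that Z_inc[of a b] Z_inc[of b a] by linarith
  have Zc: "continuous_on {0..} Z"
    unfolding continuous_on_iff
  proof (intro ballI allI impI)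
    fix a e :: real assume "a \<in> {0..}" "e > 0"
    then obtain d where "d > 0" "\<And>b. b \<ge> 0 \<Longrightarrow> dist b a < d \<Longrightarrow> dist (barrier b) (barrier a) < e"
      using barrier_continuous unfolding continuous_on_iff by (metis atLeast_iff)
    moreover have "dist (Z b) (Z a) \<le> dist (barrier b) (barrier a)" if "b \<ge> 0" for b
      using Z_inc'[of b a] that \<open>a \<in> {0..}\<close> by (simp add: dist_real_def)
    ultimately show "\<exists>d>0. \<forall>b\<in>{0..}. dist b a < d \<longrightarrow> dist (Z b) (Z a) < e"
      by (meson atLeast_iff le_less_trans)
  qed
  have Zn: "Z s \<le> 0" if "s \<ge> 0" for s
    using LIMSEQ_le_const2[OF Z[OF that]] frozen_sol_nonpos[OF y] by blast
  have "Z s = frozen_sol \<alpha> \<beta> \<gamma> Z s" if "s \<ge> 0" for s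
  proof (rule LIMSEQ_unique[OF Z[OF that]])
    show "(\<lambda>n. ?z (k n) s) \<longlonglongrightarrow> frozen_sol \<alpha> \<beta> \<gamma> Z s"
      by (intro frozen_sol_tendsto y transfer k Z Zc Zn) auto
  qed
  with k(1) Zc Zn Z that show thesis by blast
qed

text \<open>The explicit singular solution: its slope \<open>- \<theta> / s\<close> gives the flux
  \<open>- (\<theta> powr (\<beta> + 1)) * s powr \<kappa>\<close>, whose derivative balances
  \<open>s powr \<gamma> * exp\<close> of it.\<close>

definition singular_gelfand :: "real \<Rightarrow> real" where
  "singular_gelfand s = ln (\<theta> powr (\<beta> + 1) * \<kappa>) - \<theta> * ln s"

text \<open>In the variables \<open>x = ln s\<close>, \<open>w = Z - singular_gelfand\<close> and
  \<open>P = (- s Z'(s) / \<theta>) powr (\<beta> + 1)\<close> the limit equation is the autonomous system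
  \<open>w' = \<theta> (1 - P powr m)\<close>, \<open>P' = \<kappa> (exp w - P)\<close>.\<close>

lemma gelfand_oscillates:
  assumes focus: "\<kappa> < 4 * \<theta> / (\<beta> + 1)"
    and Z: "continuous_on {0..} Z" "\<And>s. s \<ge> 0 \<Longrightarrow> Z s \<le> 0"
    and eq: "\<And>s. s \<ge> 0 \<Longrightarrow> Z s = frozen_sol \<alpha> \<beta> \<gamma> Z s"
    and \<sigma>: "\<sigma> = 1 \<or> \<sigma> = (-1::real)"
  shows "\<exists>s>S. s > 0 \<and> \<sigma> * (Z s - singular_gelfand s) < 0"
proof -
  define c where "c = \<theta> powr (\<beta> + 1)"
  have c: "c > 0" using exponents_pos by (simp add: c_def)
  define w where "w x = Z (exp x) + \<theta> * x - ln (c * \<kappa>)" for x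
  \<comment> \<open>Defined through \<open>mass\<close> rather than the derivative of
    \<open>Z\<close>, so that it is differentiable without a second derivative of
    \<open>Z\<close>.\<close>
  define P where "P x = exp (- \<kappa> * x) * mass \<gamma> Z (exp x) / c" for x
  have Pm: "\<theta> * P x powr m = exp x * slope \<alpha> \<beta> \<gamma> Z (exp x)" for x
  proof -
    have "\<theta> * P x powr m = \<theta> * ((exp (- \<kappa> * x) * mass \<gamma> Z (exp x)) powr m / c powr m)"
      using c mass_nonneg[OF Z] by (simp add: P_def powr_divide)
    also have "c powr m = \<theta>" using exponents_pos by (simp add: c_def powr_powr)
    also have "exp (- \<kappa> * x) = exp ((\<beta> + 1) * x + - \<alpha> * x)"
      by (simp add: algebra_simps)
    also have "exp ((\<beta> + 1) * x + - \<alpha> * x) = exp ((\<beta> + 1) * x) * exp x powr (- \<alpha>)"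
      unfolding exp_add by (simp add: powr_def)
    also have "(exp ((\<beta> + 1) * x) * exp x powr (- \<alpha>) * mass \<gamma> Z (exp x)) powr m
        = (exp ((\<beta> + 1) * x) * (exp x powr (- \<alpha>) * mass \<gamma> Z (exp x))) powr m"
      by (simp only: mult.assoc)
    also have "\<dots> = exp ((\<beta> + 1) * x) powr m * slope \<alpha> \<beta> \<gamma> Z (exp x)"
      using mass_nonneg[OF Z] by (simp add: slope_def powr_mult)
    also have "exp ((\<beta> + 1) * x) powr m = exp x" using exponents_pos by (simp add: powr_def)
    finally show ?thesis using exponents_pos by simp
  qed
  have Z_deriv: "(Z has_real_derivative - slope \<alpha> \<beta> \<gamma> Z s) (at s)" if "s > 0" for s
    by (rule has_field_derivative_transform_within_open[OF frozen_sol_deriv[OF Z that], of "{0<..}"])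
      (use that eq in auto)
  have dw: "(w has_real_derivative \<theta> * (1 - P x powr m)) (at x)" for x
  proof -
    have "((\<lambda>x. Z (exp x)) has_real_derivative - slope \<alpha> \<beta> \<gamma> Z (exp x) * exp x) (at x)"
      by (rule DERIV_chain2[OF Z_deriv]) (auto intro!: derivative_eq_intros)
    from DERIV_diff[OF DERIV_add[OF this DERIV_cmult[OF DERIV_ident, of \<theta>]] DERIV_const[of "ln (c * \<kappa>)"]]
    show ?thesis using Pm[of x] by (simp add: w_def[abs_def] algebra_simps)
  qed
  have dP: "(P has_real_derivative \<kappa> * (exp (w x) - P x)) (at x)" for x
  proof -
    let ?M' = "exp x powr \<gamma> * exp (Z (exp x)) * exp x"
    have "((\<lambda>x. mass \<gamma> Z (exp x)) has_real_derivative ?M') (at x)"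
      by (rule DERIV_chain2[OF mass_deriv[OF Z]]) (auto intro!: derivative_eq_intros)
    moreover have "((\<lambda>x. exp (- \<kappa> * x)) has_real_derivative exp (- \<kappa> * x) * - \<kappa>) (at x)"
      by (auto intro!: derivative_eq_intros)
    ultimately have "((\<lambda>x. exp (- \<kappa> * x) * mass \<gamma> Z (exp x)) has_real_derivative
        exp (- \<kappa> * x) * - \<kappa> * mass \<gamma> Z (exp x) + ?M' * exp (- \<kappa> * x)) (at x)"
      by (intro DERIV_mult)
    from DERIV_cdivide[OF this, of c]
    have "(P has_real_derivative
        (exp (- \<kappa> * x) * - \<kappa> * mass \<gamma> Z (exp x) + ?M' * exp (- \<kappa> * x)) / c) (at x)"
      by (simp add: P_def[abs_def])
    moreover have "?M' * exp (- \<kappa> * x) = exp (Z (exp x) + \<theta> * x)"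
      by (simp add: powr_def exp_add[symmetric] theta_def algebra_simps)
    then have "?M' * exp (- \<kappa> * x) = c * \<kappa> * exp (w x)"
      using c exponents_pos by (simp add: w_def exp_diff)
    then have "(exp (- \<kappa> * x) * - \<kappa> * mass \<gamma> Z (exp x) + ?M' * exp (- \<kappa> * x)) / c = \<kappa> * (exp (w x) - P x)"
      using c by (simp add: P_def field_simps)
    ultimately show ?thesis by simp
  qed
  have pos: "P x > 0" for x using mass_pos[OF Z] c by (simp add: P_def)
  have ne: "w x \<noteq> 0 \<or> P x \<noteq> 1" for x
  proof (rule ccontr)
    assume "\<not> ?thesis"
    then have "w x = 0" "P x = 1" by auto
    \<comment> \<open>From the equilibrium, \<open>w\<close> would vanish everywhere to the left;
      but \<open>Z \<le> 0\<close> gives \<open>w a \<le> \<theta> * a - ln (c * \<kappa>)\<close>,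
      which is at most -1 at this point.\<close>
    define a where "a = min x ((ln (c * \<kappa>) - 1) / \<theta>)"
    have "w a = 0"
      by (rule equilibrium_unreachable[OF exponents_pos(1,2,5,6) dw dP pos \<open>w x = 0\<close> \<open>P x = 1\<close>])
        (simp add: a_def)
    moreover have "\<theta> * a \<le> \<theta> * ((ln (c * \<kappa>) - 1) / \<theta>)"
      using exponents_pos by (intro mult_left_mono) (auto simp: a_def)
    then have "\<theta> * a \<le> ln (c * \<kappa>) - 1" using exponents_pos by simp
    then have "w a \<le> -1" using Z(2)[of "exp a"] by (simp add: w_def)
    ultimately show False by simp
  qed
  obtain x where x: "x > ln (max S 1)" "\<sigma> * w x < 0"
    using gelfand_system_changes_sign[OF exponents_pos(1,2,5) _ dw dP pos ne \<sigma>] focus by auto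
  have "exp x > max S 1" using x(1) by (metis exp_less_mono exp_ln less_max_iff_disj zero_less_one)
  moreover have "Z (exp x) - singular_gelfand (exp x) = w x"
    by (simp add: singular_gelfand_def w_def c_def)
  ultimately show ?thesis using x(2) by (intro exI[of _ "exp x"]) auto
qed

text \<open>Integrating the equation twice from 0: the flux vanishes at 0, so it equals minus the
  mass, and its sign allows the power law to be inverted. Derivatives are needed only inside
  \<open>(0,K)\<close>, so \<open>s = K\<close> is covered by continuity.\<close>

lemma regular_eq_frozen_sol:
  assumes z: "continuous_on {0..K} z" "z 0 = 0"
    and dz: "continuous_on {0..<K} dz" "dz 0 = 0"
    and der: "\<And>s. 0 < s \<Longrightarrow> s < K \<Longrightarrow> (z has_real_derivative dz s) (at s)"
    and eqn: "\<And>s. 0 < s \<Longrightarrow> s < K \<Longrightarrow> (flux \<alpha> \<beta> dz has_real_derivative - (s powr \<gamma> * exp (y s))) (at s)"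
    and s: "0 \<le> s" "s \<le> K"
  shows "z s = frozen_sol \<alpha> \<beta> \<gamma> y s" and "z s \<le> 0"
proof -
  have \<alpha>: "\<alpha> > 0" using exponents_pos by simp
  have flux_cont: "continuous_on {0..<K} (flux \<alpha> \<beta> dz)"
  proof -
    have "continuous_on UNIV (\<lambda>p::real. \<bar>p\<bar> powr \<beta> * p)"
    \<comment> \<open>Separate because \<open>0 powr 0 = 0\<close> makes
      \<open>\<bar>p\<bar> powr 0\<close> discontinuous at 0; only its product with \<open>p\<close>
      is continuous.\<close>
    proof (cases "\<beta> = 0")
      case True
      then have "(\<lambda>p::real. \<bar>p\<bar> powr \<beta> * p) = (\<lambda>p. p)" by auto
      then show ?thesis by (metis continuous_on_id)
    next
      case False
      then show ?thesis using exponents_pos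
        by (intro continuous_on_mult continuous_on_powr' continuous_on_rabs continuous_on_id continuous_on_const) auto
    qed
    then have p: "continuous_on {0..<K} (\<lambda>s. \<bar>dz s\<bar> powr \<beta> * dz s)"
      by (rule continuous_on_compose2[OF _ dz(1)]) auto
    have "continuous_on {0..<K} (\<lambda>s. s powr \<alpha>)"
      using \<alpha> by (intro continuous_on_powr' continuous_on_id continuous_on_const) auto
    from continuous_on_mult[OF this p] show ?thesis by (simp add: flux_def[abs_def] mult.assoc)
  qed
  have mass: "flux \<alpha> \<beta> dz x = - mass \<gamma> y x" "mass \<gamma> y x \<ge> 0" if x: "0 \<le> x" "x < K" for x
  proof -
    have "((\<lambda>\<xi>. - (\<xi> powr \<gamma> * exp (y \<xi>))) has_integral (flux \<alpha> \<beta> dz x - flux \<alpha> \<beta> dz 0)) {0..x}"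
      using x by (intro fundamental_theorem_of_calculus_interior continuous_on_subset[OF flux_cont])
        (auto simp flip: has_real_derivative_iff_has_vector_derivative intro: eqn)
    from has_integral_neg[OF this]
    have "((\<lambda>\<xi>. \<xi> powr \<gamma> * exp (y \<xi>)) has_integral - flux \<alpha> \<beta> dz x) {0..x}"
      by (simp add: flux_def[of _ _ _ 0])
    then show "flux \<alpha> \<beta> dz x = - mass \<gamma> y x" "mass \<gamma> y x \<ge> 0"
      unfolding mass_def has_integral_iff using integral_nonneg[of "\<lambda>\<xi>. \<xi> powr \<gamma> * exp (y \<xi>)" "{0..x}"]
      by simp_all
  qed
  have dz_eq: "dz x = - slope \<alpha> \<beta> \<gamma> y x" if x: "0 < x" "x < K" for x
  proof -
    have fl: "x powr \<alpha> * (\<bar>dz x\<bar> powr \<beta> * dz x) = - mass \<gamma> y x"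
      using mass(1)[of x] x by (simp add: flux_def mult.assoc)
    then have "x powr \<alpha> * (\<bar>dz x\<bar> powr \<beta> * dz x) \<le> 0" using mass(2)[of x] x by simp
    then have neg: "dz x \<le> 0"
      using x by (auto simp: mult_le_0_iff)
    have "\<bar>dz x\<bar> powr (\<beta> + 1) = x powr (- \<alpha>) * mass \<gamma> y x"
    proof -
      have "x powr (- \<alpha>) * mass \<gamma> y x = (x powr (- \<alpha>) * x powr \<alpha>) * (\<bar>dz x\<bar> powr \<beta> * \<bar>dz x\<bar>)"
        using fl neg by (simp only: abs_of_nonpos) (simp add: mult.assoc)
      also have "x powr (- \<alpha>) * x powr \<alpha> = 1" using x by (simp add: powr_minus)
      also have "\<bar>dz x\<bar> powr \<beta> * \<bar>dz x\<bar> = \<bar>dz x\<bar> powr (\<beta> + 1)" by (simp add: powr_add)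
      finally show ?thesis by simp
    qed
    then have "slope \<alpha> \<beta> \<gamma> y x = \<bar>dz x\<bar>"
      using exponents_pos by (simp add: slope_def powr_powr flip: \<open>\<bar>dz x\<bar> powr (\<beta> + 1) = _\<close>)
    then show ?thesis using neg by simp
  qed
  have "((\<lambda>x. - slope \<alpha> \<beta> \<gamma> y x) has_integral (z s - z 0)) {0..s}"
    using s dz_eq der by (intro fundamental_theorem_of_calculus_interior continuous_on_subset[OF z(1)])
      (auto simp flip: has_real_derivative_iff_has_vector_derivative)
  from has_integral_neg[OF this]
  have "(slope \<alpha> \<beta> \<gamma> y has_integral - z s) {0..s}" by (simp add: z(2))
  then show "z s = frozen_sol \<alpha> \<beta> \<gamma> y s" "z s \<le> 0"
    using has_integral_nonneg[of "slope \<alpha> \<beta> \<gamma> y" "- z s" "{0..s}"]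
    by (simp_all add: frozen_sol_def has_integral_iff slope_def)
qed

end

text \<open>The \<open>N + 1\<close> points of alternating strict sign bound \<open>N\<close>
  disjoint open intervals, each containing a zero; strictness at the endpoints makes the zeros
  distinct.\<close>

lemma card_zeros_ge:
  fixes h :: "real \<Rightarrow> real"
  assumes cont: "\<And>a b. a \<in> S \<Longrightarrow> b \<in> S \<Longrightarrow> {a..b} \<subseteq> S" "continuous_on S h"
    and x: "\<And>i. i < N \<Longrightarrow> x i < x (Suc i)" "\<And>i. i \<le> N \<Longrightarrow> x i \<in> S"
    and sgn: "\<And>i. i \<le> N \<Longrightarrow> (-1) ^ i * h (x i) > 0"
  shows "enat N \<le> nzeros h S"
proof -
  have "\<exists>z. x i < z \<and> z < x (Suc i) \<and> h z = 0" if "i < N" for i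
  proof -
    have sub: "{x i..x (Suc i)} \<subseteq> S" using cont(1) x(2) that by simp
    have "\<exists>z\<ge>x i. z \<le> x (Suc i) \<and> h z = 0"
    proof (cases "even i")
      case True
      then have "h (x i) > 0" "h (x (Suc i)) < 0" using sgn[of i] sgn[of "Suc i"] that by auto
      then show ?thesis using x(1)[OF that] continuous_on_subset[OF cont(2) sub] by (intro IVT2') auto
    next
      case False
      then have "h (x i) < 0" "h (x (Suc i)) > 0" using sgn[of i] sgn[of "Suc i"] that by auto
      then show ?thesis using x(1)[OF that] continuous_on_subset[OF cont(2) sub] by (intro IVT') auto
    qed
    then obtain z where "x i \<le> z" "z \<le> x (Suc i)" "h z = 0" by blast
    moreover have "h (x i) \<noteq> 0" "h (x (Suc i)) \<noteq> 0" using sgn[of i] sgn[of "Suc i"] that by auto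
    ultimately show ?thesis by (metis order_le_less)
  qed
  then obtain z where z: "\<And>i. i < N \<Longrightarrow> x i < z i \<and> z i < x (Suc i) \<and> h (z i) = 0" by metis
  have x_mono: "x i \<le> x j" if "i \<le> j" "j \<le> N" for i j
    using that(1,2)
  proof (induction j rule: dec_induct)
    case (step n)
    then show ?case using x(1)[of n] by simp
  qed simp
  have z_lt: "z i < z j" if "i < j" "j < N" for i j
    using z[of i] z[of j] x_mono[of "Suc i" j] that by simp
  then have inj: "inj_on z {..<N}"
    by (intro inj_onI) (metis lessThan_iff less_irrefl linorder_neqE_nat)
  have sub: "z ` {..<N} \<subseteq> {r \<in> S. h r = 0}"
  proof safe
    fix i assume "i < N"
    then show "z i \<in> S" "h (z i) = 0" using z[of i] cont(1)[of "x i" "x (Suc i)"] x(2) by auto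
  qed
  show ?thesis
  proof (cases "finite {r \<in> S. h r = 0}")
    case True
    then show ?thesis using card_mono[OF True sub] card_image[OF inj] by (simp add: nzeros_def)
  qed (simp add: nzeros_def)
qed

lemma alternating_points:
  fixes D :: "real \<Rightarrow> real"
  assumes "\<And>S \<sigma>. \<sigma> = 1 \<or> \<sigma> = (-1::real) \<Longrightarrow> \<exists>s>S. s > 0 \<and> \<sigma> * D s < 0"
  obtains x :: "nat \<Rightarrow> real" where "\<And>i. x i < x (Suc i)" "\<And>i. x i > 0" "\<And>i. (-1) ^ i * D (x i) > 0"
proof -
  have ex: "\<exists>s>S. s > 0 \<and> (-1) ^ i * D s > 0" for S and i :: nat
    using assms[of "- ((-1) ^ i)" S] by (cases "even i") auto
  have "\<exists>x. \<forall>i. (x i > 0 \<and> (-1) ^ i * D (x i) > 0) \<and> x i < x (Suc i)"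
    by (rule dependent_nat_choice) (use ex in \<open>blast, metis ex\<close>)
  then show thesis using that by blast
qed

section \<open>Intersections\<close>

locale gelfand_problem = nonlinearity f + exponents \<alpha> \<beta> \<gamma> for f \<alpha> \<beta> \<gamma>
begin

section \<open>Rescaling a single regular solution\<close>

context
  fixes \<rho> R :: real and u :: "real \<Rightarrow> real"
  assumes \<rho>: "\<rho> > 0" and reg: "regular_sol f \<alpha> \<beta> \<gamma> \<rho> u R"
begin

abbreviation "t \<equiv> f \<rho>"
abbreviation "r \<equiv> scale \<beta> \<theta> (f \<rho>)"

text \<open>Stopping at \<open>R\<close> gives a continuous function on the whole half-line, as the
  estimates for frozen solutions require, although nothing is known about \<open>u\<close> beyond
  \<open>R\<close>.\<close>

definition rescaled_nonlinearity :: "real \<Rightarrow> real" where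
  "rescaled_nonlinearity s = f (u (min (r * s) R)) - t"

lemma regular_sol_nonneg: "0 \<le> x \<Longrightarrow> x \<le> R \<Longrightarrow> u x \<ge> 0"
  using reg unfolding regular_sol_def by (cases "x = R") (auto intro: less_imp_le)

lemma regular_sol_rescaled:
  assumes s: "0 \<le> s" "r * s \<le> R"
  shows "(u (r * s) - \<rho>) / g1 t = frozen_sol \<alpha> \<beta> \<gamma> rescaled_nonlinearity s"
    and "u (r * s) \<le> \<rho>"
proof -
  have "f 0 < t" using \<rho> by (intro f_strict_mono) auto
  then have g1: "g1 t > 0" by (rule g1_pos)
  have r: "r > 0" by (rule scale_pos)
  define a where "a = r / g1 t"
  have a: "a > 0" using r g1 by (simp add: a_def)
  obtain du where u0: "u 0 = \<rho>" and cu: "continuous_on {0..R} u" and du0: "du 0 = 0" and cdu: "continuous_on {0..<R} du"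
    and ode: "\<And>x. 0 < x \<Longrightarrow> x < R \<Longrightarrow> (u has_real_derivative du x) (at x)"
      "\<And>x. 0 < x \<Longrightarrow> x < R \<Longrightarrow>
        (flux \<alpha> \<beta> du has_real_derivative - (x powr \<gamma> * exp (f (u x)))) (at x)"
    using reg unfolding regular_sol_def solves_on_def by auto
  define K where "K = R / r"
  have K: "r * s \<le> R \<longleftrightarrow> s \<le> K" "r * s < R \<longleftrightarrow> s < K" for s
    using r by (simp_all add: K_def pos_le_divide_eq pos_less_divide_eq mult.commute)
  define z where "z s = (u (r * s) - \<rho>) / g1 t" for s
  define dz where "dz s = a * du (r * s)" for s
  have zc: "continuous_on {0..K} z"
    unfolding z_def using r g1 K
    by (intro continuous_intros continuous_on_compose2[OF cu]) (auto simp: less_imp_neq)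
  have dzc: "continuous_on {0..<K} dz"
    unfolding dz_def using r K by (intro continuous_intros continuous_on_compose2[OF cdu]) auto
  have der: "(z has_real_derivative dz s) (at s)" if "0 < s" "s < K" for s
  proof -
    have "((\<lambda>s. u (r * s)) has_real_derivative du (r * s) * r) (at s)"
      using that r K by (intro DERIV_chain2[OF ode(1)]) (auto intro!: derivative_eq_intros)
    from DERIV_cdivide[OF DERIV_diff[OF this DERIV_const[of \<rho>]], of "g1 t"]
    show ?thesis by (simp add: z_def[abs_def] dz_def a_def mult.commute)
  qed
  have eqn: "(flux \<alpha> \<beta> dz has_real_derivative - (s powr \<gamma> * exp (rescaled_nonlinearity s))) (at s)"
    if s: "0 < s" "s < K" for s
  proof -
    let ?c = "a powr (\<beta> + 1) * r powr (- \<alpha>)"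
    have fl: "?c * flux \<alpha> \<beta> du (r * x) = flux \<alpha> \<beta> dz x" if "x > 0" for x
    proof -
      have "flux \<alpha> \<beta> dz x = x powr \<alpha> * (a powr \<beta> * \<bar>du (r * x)\<bar> powr \<beta>) * (a * du (r * x))"
        using a by (simp add: flux_def dz_def abs_mult powr_mult)
      moreover have "flux \<alpha> \<beta> du (r * x) = r powr \<alpha> * x powr \<alpha> * \<bar>du (r * x)\<bar> powr \<beta> * du (r * x)"
        using r that by (simp add: flux_def powr_mult)
      moreover have "a powr (\<beta> + 1) = a powr \<beta> * a" using a by (simp add: powr_add)
      moreover have "r powr (- \<alpha>) * r powr \<alpha> = 1" using r by (simp add: powr_minus)
      ultimately show ?thesis by (simp add: algebra_simps)
    qed
    have "((\<lambda>s. flux \<alpha> \<beta> du (r * s)) has_real_derivative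
        - ((r * s) powr \<gamma> * exp (f (u (r * s)))) * r) (at s)"
      using s r K by (intro DERIV_chain2[OF ode(2)]) (auto intro!: derivative_eq_intros)
    from DERIV_cmult[OF this, of ?c]
    have "((\<lambda>s. ?c * flux \<alpha> \<beta> du (r * s)) has_real_derivative
        - (?c * ((r * s) powr \<gamma> * exp (f (u (r * s)))) * r)) (at s)" by (simp add: mult.assoc)
    then have "(flux \<alpha> \<beta> dz has_real_derivative
        - (?c * ((r * s) powr \<gamma> * exp (f (u (r * s)))) * r)) (at s)"
      by (rule has_field_derivative_transform_within_open[of _ _ _ "{0<..}"]) (use s fl in auto)
    moreover have "?c * ((r * s) powr \<gamma> * exp (f (u (r * s)))) * r = s powr \<gamma> * exp (rescaled_nonlinearity s)"
    proof -
      \<comment> \<open>All powers of \<open>r\<close>, \<open>g1 t\<close> and \<open>exp t\<close>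
        collected in one exponent; it vanishes by \<open>ln_scale\<close>.\<close>
      have "a powr (\<beta> + 1) = exp ((\<beta> + 1) * (ln r - ln (g1 t)))"
        using a r g1 by (simp add: powr_def a_def ln_div)
      then have "?c * r powr \<gamma> * r * exp t
          = exp ((\<beta> + 1) * (ln r - ln (g1 t)) + - \<alpha> * ln r + \<gamma> * ln r + ln r + t)"
        unfolding exp_add using r by (simp add: powr_def)
      also have "\<dots> = exp (\<theta> * ln r - ((\<beta> + 1) * ln (g1 t) - t))"
        by (simp add: theta_def algebra_simps)
      also have "\<dots> = 1" using exponents_pos by (subst ln_scale) auto
      finally have one: "?c * r powr \<gamma> * r * exp t = 1" .
      have "exp (f (u (r * s))) = exp t * exp (rescaled_nonlinearity s)"
        using s K(2)[of s] by (simp add: rescaled_nonlinearity_def flip: exp_add)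
      then have "?c * ((r * s) powr \<gamma> * exp (f (u (r * s)))) * r
          = (?c * r powr \<gamma> * r * exp t) * (s powr \<gamma> * exp (rescaled_nonlinearity s))"
        using r s by (simp add: powr_mult mult_ac)
      then show ?thesis unfolding one by simp
    qed
    ultimately show ?thesis by simp
  qed
  have z0: "z 0 = 0" "dz 0 = 0" by (simp_all add: z_def dz_def u0 du0)
  note * = regular_eq_frozen_sol[OF zc z0(1) dzc z0(2) der eqn s(1)]
  show "(u (r * s) - \<rho>) / g1 t = frozen_sol \<alpha> \<beta> \<gamma> rescaled_nonlinearity s"
    using *(1) s K by (simp add: z_def)
  have "z s \<le> 0" using *(2) s K by simp
  then show "u (r * s) \<le> \<rho>" using g1 by (simp add: z_def divide_le_0_iff)
qed

lemma regular_sol_le: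
  assumes "0 \<le> x" "x \<le> R" shows "u x \<le> \<rho>"
  using regular_sol_rescaled(2)[of "x / r"] assms scale_pos[of \<beta> \<theta> t] by simp

lemma min_in_domain: "s \<ge> 0 \<Longrightarrow> min (r * s) R \<in> {0..R}"
  using reg scale_pos[of \<beta> \<theta> t] by (simp add: regular_sol_def)

lemma stopped_bounds:
  assumes "s \<ge> 0" shows "0 \<le> u (min (r * s) R)" "u (min (r * s) R) \<le> \<rho>"
proof -
  from min_in_domain[OF assms] have "0 \<le> min (r * s) R" "min (r * s) R \<le> R"
    by (simp_all only: atLeastAtMost_iff)
  then show "0 \<le> u (min (r * s) R)" "u (min (r * s) R) \<le> \<rho>"
    by (rule regular_sol_nonneg regular_sol_le)+
qed

lemma rescaled_nonlinearity_continuous: "continuous_on {0..} rescaled_nonlinearity"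
proof -
  have cu: "continuous_on {0..R} u" using reg by (simp add: regular_sol_def)
  have cm: "continuous_on {0..} (\<lambda>s. min (r * s) R)" by (intro continuous_intros)
  have "continuous_on {0..} (\<lambda>s. u (min (r * s) R))"
    by (rule continuous_on_compose2[OF cu cm], intro image_subsetI min_in_domain) simp
  then have "continuous_on {0..} (\<lambda>s. f (u (min (r * s) R)))"
    by (rule continuous_on_compose2[OF f_continuous]) (auto intro: stopped_bounds)
  then show ?thesis unfolding rescaled_nonlinearity_def[abs_def] by (intro continuous_intros)
qed

lemma rescaled_nonlinearity_nonpos: "s \<ge> 0 \<Longrightarrow> rescaled_nonlinearity s \<le> 0"
  using f_mono[OF stopped_bounds] by (simp add: rescaled_nonlinearity_def)

text \<open>Between 0 and \<open>R\<close> the solution falls from \<open>\<rho> = g t\<close> to 0,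
  a drop of \<open>g t / g1 t\<close> in rescaled units; the drop over a rescaled length
  \<open>s\<close> is at most \<open>barrier s\<close>.\<close>

lemma domain_bound:
  assumes "s > 0" "barrier s < g t / g1 t" shows "r * s < R"
proof (rule ccontr)
  assume "\<not> r * s < R"
  have r: "r > 0" by (rule scale_pos)
  have R: "R > 0" "u R = 0" using reg by (auto simp: regular_sol_def)
  have K: "0 \<le> R / r" "R / r \<le> s" "r * (R / r) = R"
    using r R \<open>\<not> r * s < R\<close> by (auto simp: divide_le_eq mult.commute)
  have "- (g t / g1 t) = frozen_sol \<alpha> \<beta> \<gamma> rescaled_nonlinearity (R / r)"
    using regular_sol_rescaled(1)[of "R / r"] K R g_f[of \<rho>] \<rho> by simp
  also have "\<dots> \<ge> - barrier (R / r)"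
    using rescaled_nonlinearity_continuous rescaled_nonlinearity_nonpos K by (intro frozen_sol_ge)
  finally show False using barrier_mono[OF K(1,2)] assms(2) by linarith
qed

end

text \<open>By contradiction along a sequence \<open>\<rho> n\<close> violating the count: a
  subsequence converges to some fixed point, and the oscillation of that limit restores the zeros
  for a member of the sequence.\<close>

lemma many_intersections:
  assumes focus: "\<kappa> < 4 * \<theta> / (\<beta> + 1)"
    and v: "singular_sol_thm11 f \<alpha> \<beta> \<gamma> lam v"
    and U: "\<And>\<rho>. \<rho> > 0 \<Longrightarrow> regular_sol f \<alpha> \<beta> \<gamma> \<rho> (U \<rho>) (R \<rho>)"
    and "\<delta> > 0"
  shows "\<forall>\<^sub>F \<rho> in at_top. enat N \<le> nzeros (\<lambda>r. U \<rho> r - v (r * lam powr (- 1 / \<theta>)))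
      {r. 0 < r \<and> r < \<delta> \<and> r < R \<rho> \<and> r < lam powr (1 / \<theta>)}" (is "eventually ?good at_top")
proof (rule ccontr)
  assume not_ev: "\<not> eventually ?good at_top"
  define good where "good = ?good"
  have "\<exists>\<rho>\<ge>real n + 1. \<not> good \<rho>" for n :: nat
    using not_ev unfolding good_def[symmetric] eventually_at_top_linorder by blast
  then obtain \<rho> where \<rho>: "\<And>n. \<rho> n \<ge> real n + 1" and bad: "\<And>n. \<not> good (\<rho> n)" by metis
  have \<rho>_pos: "\<rho> n > 0" for n using \<rho>[of n] by linarith
  note reg = U[OF \<rho>_pos]
  have "real n \<le> \<rho> n" for n using \<rho>[of n] by linarith
  then have "filterlim \<rho> at_top sequentially"
    by (intro filterlim_at_top_mono[OF filterlim_real_sequentially] always_eventually allI)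
  from filterlim_compose[OF f_at_top this] have T: "filterlim (\<lambda>n. f (\<rho> n)) at_top sequentially" .
  define y where "y n = rescaled_nonlinearity (\<rho> n) (R (\<rho> n)) (U (\<rho> n))" for n
  define r where "r n = scale \<beta> \<theta> (f (\<rho> n))" for n
  have r: "r n > 0" for n by (simp add: r_def scale_pos)
  have g1: "g1 (f (\<rho> n)) > 0" for n using f_strict_mono[OF _ \<rho>_pos] by (intro g1_pos) auto
  have y: "continuous_on {0..} (y n)" "s \<ge> 0 \<Longrightarrow> y n s \<le> 0" for n s
    unfolding y_def
    using rescaled_nonlinearity_continuous[OF \<rho>_pos reg] rescaled_nonlinearity_nonpos[OF \<rho>_pos reg] by auto
  have dom: "\<forall>\<^sub>F n in sequentially. r n * s < R (\<rho> n)" if "s > 0" for s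
  proof -
    have "\<forall>\<^sub>F n in sequentially. barrier s < g (f (\<rho> n)) / g1 (f (\<rho> n))"
      using filterlim_compose[OF g_over_g1_at_top T] by (simp add: filterlim_at_top_dense)
    then show ?thesis
      by eventually_elim (unfold r_def, rule domain_bound[OF \<rho>_pos reg that])
  qed
  have frozen: "(U (\<rho> n) (r n * s) - g (f (\<rho> n))) / g1 (f (\<rho> n)) = frozen_sol \<alpha> \<beta> \<gamma> (y n) s"
    if "r n * s < R (\<rho> n)" "s > 0" for n s
    using regular_sol_rescaled(1)[OF \<rho>_pos reg, of s n] that g_f[of "\<rho> n"] \<rho>_pos[of n]
    by (simp add: y_def r_def)
  have transfer: "(\<lambda>n. y (k n) s) \<longlonglongrightarrow> l"
    if s: "s > 0" and k: "strict_mono k" and l: "(\<lambda>n. frozen_sol \<alpha> \<beta> \<gamma> (y (k n)) s) \<longlonglongrightarrow> l" for s k l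
  proof -
    let ?u = "\<lambda>n. U (\<rho> (k n)) (min (r (k n) * s) (R (\<rho> (k n))))"
    note sub = filterlim_subseq[OF k]
    have "\<forall>\<^sub>F n in sequentially. r (k n) * s < R (\<rho> (k n))"
      using eventually_compose_filterlim[OF dom[OF s] sub] .
    then have "\<forall>\<^sub>F n in sequentially. frozen_sol \<alpha> \<beta> \<gamma> (y (k n)) s = (?u n - g (f (\<rho> (k n)))) / g1 (f (\<rho> (k n)))"
      by eventually_elim (use frozen s in \<open>simp add: min_absorb1\<close>)
    with l have "(\<lambda>n. (?u n - g (f (\<rho> (k n)))) / g1 (f (\<rho> (k n)))) \<longlonglongrightarrow> l"
      by (rule Lim_transform_eventually)
    moreover have "?u n \<ge> 0" for n
      using stopped_bounds(1)[OF \<rho>_pos reg, of s "k n"] s by (simp add: r_def)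
    ultimately have "(\<lambda>n. f (?u n) - f (\<rho> (k n))) \<longlonglongrightarrow> l"
      by (intro f_increment_tendsto filterlim_compose[OF T sub])
    then show ?thesis by (simp add: y_def rescaled_nonlinearity_def[OF \<rho>_pos reg] r_def)
  qed
  obtain k Z where k: "strict_mono k" and Z: "continuous_on {0..} Z" "\<And>s. s \<ge> 0 \<Longrightarrow> Z s \<le> 0"
    "\<And>s. s \<ge> 0 \<Longrightarrow> Z s = frozen_sol \<alpha> \<beta> \<gamma> Z s"
    and lim: "\<And>s. s \<ge> 0 \<Longrightarrow> (\<lambda>n. frozen_sol \<alpha> \<beta> \<gamma> (y (k n)) s) \<longlonglongrightarrow> Z s"
  proof (rule frozen_sol_compactness[of y])
    show "continuous_on {0..} (y n)" for n by (rule y)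
    show "y n s \<le> 0" if "s \<ge> 0" for n s using that by (rule y)
    show "(\<lambda>n. y (k n) s) \<longlonglongrightarrow> l"
      if "s > 0" "strict_mono k" "(\<lambda>n. frozen_sol \<alpha> \<beta> \<gamma> (y (k n)) s) \<longlonglongrightarrow> l" for s k l
      using that by (rule transfer)
  qed (rule that)
  note sub = filterlim_subseq[OF k]
  obtain x where x: "\<And>i. x i < x (Suc i)" "\<And>i. x i > 0"
    "\<And>i. (-1) ^ i * (Z (x i) - singular_gelfand (x i)) > 0"
  proof (rule alternating_points[of "\<lambda>s. Z s - singular_gelfand s"])
    show "\<exists>s>S. s > 0 \<and> \<sigma> * (Z s - singular_gelfand s) < 0" if "\<sigma> = 1 \<or> \<sigma> = -1" for S \<sigma>
      using gelfand_oscillates[OF focus Z that] .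
  qed (rule that)
  define h where "h n r = U (\<rho> n) r - v (r * lam powr (- 1 / \<theta>))" for n r
  have sgn: "\<forall>\<^sub>F n in sequentially. (-1) ^ i * h (k n) (r (k n) * x i) > 0" for i
  proof -
    let ?s = "x i"
    have "(\<lambda>n. (v (r (k n) * ?s * lam powr (- 1 / \<theta>)) - g (f (\<rho> (k n)))) / g1 (f (\<rho> (k n))))
        \<longlonglongrightarrow> singular_gelfand ?s"
      using filterlim_compose[OF singular_solution_rescaled[OF A6 v x(2)] filterlim_compose[OF T sub]]
      by (simp add: r_def singular_gelfand_def)
    then have "(\<lambda>n. (-1) ^ i * (frozen_sol \<alpha> \<beta> \<gamma> (y (k n)) ?s
          - (v (r (k n) * ?s * lam powr (- 1 / \<theta>)) - g (f (\<rho> (k n)))) / g1 (f (\<rho> (k n)))))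
        \<longlonglongrightarrow> (-1) ^ i * (Z ?s - singular_gelfand ?s)"
      using x(2)[of i] by (intro tendsto_intros lim) auto
    from order_tendstoD(1)[OF this x(3)] eventually_compose_filterlim[OF dom[OF x(2)[of i]] sub]
    show ?thesis
    proof eventually_elim
      case (elim n)
      \<comment> \<open>The common centre \<open>g (f (\<rho> (k n)))\<close> cancels, so the
        rescaled difference has the sign of \<open>h\<close>.\<close>
      have "frozen_sol \<alpha> \<beta> \<gamma> (y (k n)) ?s
          - (v (r (k n) * ?s * lam powr (- 1 / \<theta>)) - g (f (\<rho> (k n)))) / g1 (f (\<rho> (k n)))
          = h (k n) (r (k n) * ?s) / g1 (f (\<rho> (k n)))"
        unfolding frozen[OF elim(2) x(2), symmetric] h_def by (simp flip: diff_divide_distrib)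
      with elim(1) g1[of "k n"] show ?case by (simp add: zero_less_divide_iff)
    qed
  qed
  \<comment> \<open>Below \<open>lam powr (1 / \<theta>)\<close> the rescaled argument of
    \<open>v\<close> stays inside \<open>(0,1)\<close>, where \<open>v\<close> is
    continuous.\<close>
  define b where "b = min \<delta> (lam powr (1 / \<theta>))"
  have lam: "lam > 0" using v by (simp add: singular_sol_thm11_def)
  have "b > 0" using \<open>\<delta> > 0\<close> lam by (simp add: b_def)
  have "(\<lambda>n. r n * x N) \<longlonglongrightarrow> 0 * x N"
    unfolding r_def using exponents_pos by (intro tendsto_intros filterlim_compose[OF scale_tendsto_0 T])
  then have "\<forall>\<^sub>F n in sequentially. r n * x N < b"
    using order_tendstoD(2)[of _ 0 _ b] \<open>b > 0\<close> by simp
  note small = eventually_compose_filterlim[OF this sub]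
  have "\<forall>\<^sub>F n in sequentially. \<forall>i\<in>{..N}. (-1) ^ i * h (k n) (r (k n) * x i) > 0"
    by (intro eventually_ball_finite ballI sgn) simp
  with small eventually_compose_filterlim[OF dom[OF x(2)[of N]] sub]
  have "\<forall>\<^sub>F n in sequentially. r (k n) * x N < b \<and> r (k n) * x N < R (\<rho> (k n)) \<and>
      (\<forall>i\<in>{..N}. (-1) ^ i * h (k n) (r (k n) * x i) > 0)"
    by eventually_elim blast
  from eventually_happens'[OF sequentially_bot this]
  obtain n where n: "r (k n) * x N < b" "r (k n) * x N < R (\<rho> (k n))"
    "\<And>i. i \<le> N \<Longrightarrow> (-1) ^ i * h (k n) (r (k n) * x i) > 0"
    by blast
  let ?S = "{r. 0 < r \<and> r < \<delta> \<and> r < R (\<rho> (k n)) \<and> r < lam powr (1 / \<theta>)}"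
  have "enat N \<le> nzeros (h (k n)) ?S"
  proof (rule card_zeros_ge[where x = "\<lambda>i. r (k n) * x i"])
    show "{a..b} \<subseteq> ?S" if "a \<in> ?S" "b \<in> ?S" for a b using that by auto
    show "r (k n) * x i < r (k n) * x (Suc i)" for i using x(1) r by simp
    show "r (k n) * x i \<in> ?S" if "i \<le> N" for i
    proof -
      have "x i \<le> x N" using lift_Suc_mono_le[of x i N] x(1) that by (simp add: less_imp_le)
      then have "r (k n) * x i \<le> r (k n) * x N" using r[of "k n"] by simp
      moreover have "0 < r (k n) * x i" using r x(2) by simp
      moreover have "r (k n) * x N < \<delta>" "r (k n) * x N < lam powr (1 / \<theta>)"
        using n(1) by (simp_all only: b_def min_less_iff_conj)
      ultimately show ?thesis using n(2) by (intro CollectI conjI) linarith+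
    qed
    have "continuous_on {0..R (\<rho> (k n))} (U (\<rho> (k n)))" using reg[of "k n"] by (simp add: regular_sol_def)
    then have U: "continuous_on ?S (U (\<rho> (k n)))" by (rule continuous_on_subset) auto
    have "continuous_on {0<..1} v" using v by (simp add: singular_sol_thm11_def)
    then have "continuous_on ?S (\<lambda>r. v (r * lam powr (- 1 / \<theta>)))"
    proof (rule continuous_on_compose2)
      have "lam powr (1 / \<theta>) * lam powr (- 1 / \<theta>) = 1" using lam by (simp add: powr_minus flip: powr_add)
      then have "r * lam powr (- 1 / \<theta>) \<le> 1" if "r < lam powr (1 / \<theta>)" for r
        using mult_right_mono[of r "lam powr (1 / \<theta>)" "lam powr (- 1 / \<theta>)"] that by simp
      then show "(\<lambda>r. r * lam powr (- 1 / \<theta>)) ` ?S \<subseteq> {0<..1}" using lam by auto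
    qed (intro continuous_intros)
    with U show "continuous_on ?S (h (k n))" unfolding h_def[abs_def] by (intro continuous_on_diff)
  qed (use n(3) in auto)
  with bad[of "k n"] show False by (simp add: good_def h_def[abs_def])
qed

end

theorem theorem1p4:
  fixes f :: "real \<Rightarrow> real" and \<alpha> \<beta> \<gamma> lam :: real
    and v :: "real \<Rightarrow> real" and U :: "real \<Rightarrow> real \<Rightarrow> real" and R :: "real \<Rightarrow> real"
  assumes "A1 f" "A2 f" "A3 f" "A4 f" "A5 f" "A6 \<alpha> \<beta> \<gamma>"
    and "\<alpha> - \<beta> - 1 < 4 * theta \<alpha> \<beta> \<gamma> / (\<beta> + 1)"
    and "singular_sol_thm11 f \<alpha> \<beta> \<gamma> lam v"
    and "\<forall>\<rho>>0. regular_sol f \<alpha> \<beta> \<gamma> \<rho> (U \<rho>) (R \<rho>)"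
  shows "\<forall>\<delta>>0. \<forall>N::nat. \<forall>\<^sub>F \<rho> in at_top.
    enat N \<le> nzeros (\<lambda>r. U \<rho> r - v (r * lam powr (- 1 / theta \<alpha> \<beta> \<gamma>)))
                 {r. 0 < r \<and> r < \<delta> \<and> r < R \<rho> \<and> r < lam powr (1 / theta \<alpha> \<beta> \<gamma>)}"
proof -
  interpret gelfand_problem f \<alpha> \<beta> \<gamma>
    using assms(1-6) by unfold_locales
  show ?thesis using many_intersections[OF assms(7,8)] assms(9) by blast
qed

end
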